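(* Let $f(x)=\frac{\Gamma(x)^2}{2\Gamma(2x)}$ for $x>0$. Then $$\sum_{k=1}^{\infty}f^{(4)}(k)=-72\,\zeta(3)L_{-3}(2)+\frac{134\pi^5}{243\sqrt3}-32\sqrt3\,\operatorname{Gl}_{4,1}\left(\frac{\pi}{3}\right).$$
   Context: $f^{(4)}$ is the fourth derivative of $f$. $\chi_{-3}$ is the primitive Dirichlet character modulo $3$: $\chi_{-3}(n)=0,1,-1$ according as $n\equiv0,1,2\pmod 3$, and $L_{-3}(s)=\sum_{n=1}^\infty\chi_{-3}(n)n^{-s}$ for $\Re s>0$. $\zeta$ is the Riemann zeta function. $\operatorname{Gl}_{4,1}(\theta)=\Im\operatorname{Li}_{4,1}(e^{i\theta})$, where $\operatorname{Li}_{4,1}(z)=\sum_{n_1>n_2\ge1}\frac{z^{n_1}}{n_1^{4}n_2}$. *)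

theory Defs
  imports "HOL-Analysis.Analysis"
begin

text \<open>
  The Riemann zeta function by its Dirichlet series. It agrees with the analytic
  continuation only on \<open>Re s > 1\<close>.
\<close>

definition riemann_zeta :: "complex \<Rightarrow> complex" where
  "riemann_zeta s = (\<Sum>n. 1 / of_nat (Suc n) powr s)"

definition chi_m3 :: "nat \<Rightarrow> int" where
  "chi_m3 n = (if n mod 3 = 0 then 0 else if n mod 3 = 1 then 1 else - 1)"

text \<open>
  For \<open>0 < Re s \<le> 1\<close> the series converges only conditionally, so it is summed in the
  natural order.
\<close>

definition L_m3 :: "complex \<Rightarrow> complex" where
  "L_m3 s = (\<Sum>n. of_int (chi_m3 (Suc n)) * of_nat (Suc n) powr (- s))"

text \<open>
  The double series converges absolutely for \<open>norm z \<le> 1\<close>, so the unordered sum over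
  index pairs is the usual one.
\<close>

definition Li41 :: "complex \<Rightarrow> complex" where
  "Li41 z = (\<Sum>\<^sub>\<infinity>(n1, n2)\<in>{(n1 :: nat, n2 :: nat). n1 > n2 \<and> n2 \<ge> 1}.
     z ^ n1 / (of_nat n1 ^ 4 * of_nat n2))"

definition Gl41 :: "real \<Rightarrow> real" where
  "Gl41 \<theta> = Im (Li41 (exp (\<i> * of_real \<theta>)))"

text \<open>
  Only the values at \<open>x > 0\<close> are meaningful.
\<close>

definition gamma_ratio :: "real \<Rightarrow> real" where
  "gamma_ratio x = Gamma x ^ 2 / (2 * Gamma (2 * x))"

end

theory Submission
  imports Defs "HOL-Real_Asymp.Real_Asymp"
begin

text \<open>
  Since \<open>2 * gamma_ratio x\<close> is the Beta integral of \<open>(t * (1 - t)) powr (x - 1)\<close> over the unit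
  interval, twice the sum is the integral of \<open>ln (t * (1 - t)) ^ 4 * w t\<close> with
  \<open>w t = 1 / (1 - t + t^2)\<close>. Writing \<open>a = ln t\<close> and \<open>b = ln (1 - t)\<close>, we have
  \<open>(a + b)^4 = (a - b)^4 + 8 * (a^3 * b + a * b^3)\<close>. The substitution \<open>u = t / (1 - t)\<close> turns the
  first part into the integral of \<open>ln u ^ 4 / (1 + u + u^2)\<close>, a Bernoulli value. The other two
  terms are equal by the symmetry of \<open>w\<close>; expanding \<open>w\<close> into a sine series and \<open>b\<close> into powers
  of \<open>t\<close> gives the double series of \<open>\<omega>^n / (m * (m + n)^4)\<close> at \<open>\<omega> = exp (\<i> * pi / 3)\<close>.
  By partial fractions, which amount to the shuffle product of \<open>Li_1\<close> and \<open>Li_4\<close>, it equals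
  \<open>Li_1 * (Li_4 - \<zeta>(4)) - \<zeta>(3) * Li_2 - \<zeta>(2) * Li_3 - Li_{4,1} + 4 * Li_5\<close> for every
  \<open>\<omega> \<noteq> 1\<close> in the closed unit disc. On the unit circle the imaginary parts of \<open>Li_1\<close>, \<open>Li_3\<close>
  and \<open>Li_5\<close> and the real part of \<open>Li_4\<close> are polynomials in the angle.
\<close>

section \<open>Derivatives of integrals of Laplace type\<close>

lemma power_div_fact_le_exp:
  fixes y :: real
  assumes "y \<ge> 0"
  shows "y ^ j / fact j \<le> exp y"
proof -
  have "(\<lambda>n. y ^ n / fact n) sums exp y"
    using exp_converges[of y] by (simp add: field_simps)
  then show ?thesis
    using sum_le_suminf[of "\<lambda>n. y ^ n / fact n" "{j}"] assms by (auto simp: sums_iff)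
qed

text \<open>Half of the exponential decay pays for the power of \<open>\<phi>\<close>: with
  \<open>y = - (x / 2) * \<phi> t\<close> one has \<open>y ^ j * exp (- y) \<le> fact j\<close>,
  which leaves the integrable function at \<open>x / 2\<close>.\<close>

lemma laplace_moment_integrable:
  fixes q \<phi> :: "'a \<Rightarrow> real"
  assumes [measurable]: "q \<in> borel_measurable M" "\<phi> \<in> borel_measurable M"
    and int: "\<And>x. x > 0 \<Longrightarrow> integrable M (\<lambda>t. q t * exp (x * \<phi> t))"
    and neg: "\<And>t. t \<in> space M \<Longrightarrow> \<phi> t \<le> 0"
    and "x > 0"
  shows "integrable M (\<lambda>t. q t * \<phi> t ^ j * exp (x * \<phi> t))"
proof (rule Bochner_Integration.integrable_bound)
  show "integrable M (\<lambda>t. (fact j * (2 / x) ^ j) * (q t * exp ((x / 2) * \<phi> t)))"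
    using int[of "x / 2"] \<open>x > 0\<close> by (intro integrable_mult_right) auto
  show "AE t in M. norm (q t * \<phi> t ^ j * exp (x * \<phi> t))
      \<le> norm (fact j * (2 / x) ^ j * (q t * exp (x / 2 * \<phi> t)))"
  proof (rule AE_I2)
    fix t assume "t \<in> space M"
    define y where "y = - (x / 2) * \<phi> t"
    have "y \<ge> 0"
      using neg[OF \<open>t \<in> space M\<close>] \<open>x > 0\<close> by (simp add: y_def mult_nonneg_nonpos)
    have "\<bar>\<phi> t\<bar> = (2 / x) * y"
      using neg[OF \<open>t \<in> space M\<close>] \<open>x > 0\<close> by (simp add: y_def)
    moreover have "exp (x * \<phi> t) = exp (- y) * exp (x / 2 * \<phi> t)"
      by (simp add: y_def flip: exp_add)
    moreover have "y ^ j * exp (- y) \<le> fact j"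
      using power_div_fact_le_exp[OF \<open>y \<ge> 0\<close>, of j]
      by (simp add: exp_minus field_simps)
    ultimately have "\<bar>\<phi> t\<bar> ^ j * exp (x * \<phi> t)
        \<le> fact j * (2 / x) ^ j * exp (x / 2 * \<phi> t)"
    proof -
      have "(2 / x) ^ j * exp (x / 2 * \<phi> t) * (y ^ j * exp (- y))
          \<le> (2 / x) ^ j * exp (x / 2 * \<phi> t) * fact j"
        using \<open>x > 0\<close> \<open>y ^ j * exp (- y) \<le> fact j\<close> by (intro mult_left_mono) auto
      then show ?thesis
        unfolding \<open>\<bar>\<phi> t\<bar> = (2 / x) * y\<close> \<open>exp (x * \<phi> t) = _\<close> power_mult_distrib
        by (simp only: ac_simps)
    qed
    from mult_left_mono[OF this, of "\<bar>q t\<bar>"]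
    show "norm (q t * \<phi> t ^ j * exp (x * \<phi> t))
      \<le> norm (fact j * (2 / x) ^ j * (q t * exp (x / 2 * \<phi> t)))"
      using \<open>x > 0\<close> by (simp add: abs_mult power_abs ac_simps)
  qed
qed measurable

text \<open>Differentiation under the integral sign by a quadratic remainder estimate: the
  integrated first-order Taylor remainder is at most \<open>h\<^sup>2 * C\<close>, where
  \<open>C\<close> is a finite absolute moment at \<open>x / 2\<close>.\<close>

lemma laplace_moment_has_derivative:
  fixes q \<phi> :: "'a \<Rightarrow> real"
  assumes [measurable]: "q \<in> borel_measurable M" "\<phi> \<in> borel_measurable M"
    and int: "\<And>x. x > 0 \<Longrightarrow> integrable M (\<lambda>t. q t * exp (x * \<phi> t))"
    and neg: "\<And>t. t \<in> space M \<Longrightarrow> \<phi> t \<le> 0"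
    and x: "x > 0"
  shows "((\<lambda>x. \<integral>t. q t * \<phi> t ^ j * exp (x * \<phi> t) \<partial>M) has_field_derivative
           (\<integral>t. q t * \<phi> t ^ Suc j * exp (x * \<phi> t) \<partial>M)) (at x)"
proof -
  let ?F = "\<lambda>j x. \<integral>t. q t * \<phi> t ^ j * exp (x * \<phi> t) \<partial>M"
  have I: "integrable M (\<lambda>t. q t * \<phi> t ^ i * exp (y * \<phi> t))" if "y > 0" for i y
    using assms that by (intro laplace_moment_integrable) auto
  define C where "C = (\<integral>t. \<bar>q t * \<phi> t ^ (j + 2) * exp ((x / 2) * \<phi> t)\<bar> \<partial>M)"
  have bound: "\<bar>?F j (x + h) - ?F j x - h * ?F (Suc j) x\<bar> \<le> h\<^sup>2 * C" if h: "\<bar>h\<bar> < x / 2" for h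
  proof -
    have xh: "x + h > 0" using h by linarith
    have eq: "?F j (x + h) - ?F j x - h * ?F (Suc j) x
      = (\<integral>t. q t * \<phi> t ^ j * exp ((x + h) * \<phi> t) - q t * \<phi> t ^ j * exp (x * \<phi> t)
          - h * (q t * \<phi> t ^ Suc j * exp (x * \<phi> t)) \<partial>M)"
      using I[OF x, of j] I[OF x, of "Suc j"] I[OF xh, of j] by simp
    have "\<bar>?F j (x + h) - ?F j x - h * ?F (Suc j) x\<bar> \<le> (\<integral>t. h\<^sup>2 * \<bar>q t * \<phi> t ^ (j + 2) * exp ((x / 2) * \<phi> t)\<bar> \<partial>M)"
      unfolding eq
    proof (rule order.trans[OF integral_abs_bound], rule Bochner_Integration.integral_mono)
      show "integrable M (\<lambda>t. \<bar>q t * \<phi> t ^ j * exp ((x + h) * \<phi> t) - q t * \<phi> t ^ j * exp (x * \<phi> t)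
          - h * (q t * \<phi> t ^ Suc j * exp (x * \<phi> t))\<bar>)"
        using I[OF x, of j] I[OF x, of "Suc j"] I[OF xh, of j]
        by (intro integrable_abs Bochner_Integration.integrable_diff integrable_mult_right)
      show "integrable M (\<lambda>t. h\<^sup>2 * \<bar>q t * \<phi> t ^ (j + 2) * exp ((x / 2) * \<phi> t)\<bar>)"
        using I[of "x / 2" "j + 2"] x by (intro integrable_mult_right integrable_abs) auto
      fix t assume t: "t \<in> space M"
      define u where "u = h * \<phi> t"
      have eq: "q t * \<phi> t ^ j * exp ((x + h) * \<phi> t) - q t * \<phi> t ^ j * exp (x * \<phi> t)
          - h * (q t * \<phi> t ^ Suc j * exp (x * \<phi> t))
          = (q t * \<phi> t ^ j) * (exp (x * \<phi> t) * (exp u - (1 + u)))"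
        by (simp add: u_def algebra_simps exp_add)
      have "\<bar>exp u - (1 + u)\<bar> \<le> exp \<bar>u\<bar> * u\<^sup>2"
        using Taylor_exp_field[of u 1] by (simp add: numeral_2_eq_2)
      \<comment> \<open>The condition \<open>\<bar>h\<bar> < x / 2\<close> means that the factor
        \<open>exp \<bar>u\<bar>\<close> uses up at most half of the decay.\<close>
      moreover have "exp (x * \<phi> t) * exp \<bar>u\<bar> \<le> exp ((x / 2) * \<phi> t)"
      proof -
        have "\<bar>u\<bar> \<le> (x / 2) * (- \<phi> t)"
          unfolding u_def abs_mult using h neg[OF t] by (intro mult_mono) auto
        then show ?thesis by (simp flip: exp_add)
      qed
      ultimately have "exp (x * \<phi> t) * \<bar>exp u - (1 + u)\<bar> \<le> exp ((x / 2) * \<phi> t) * u\<^sup>2"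
        by (smt (verit, best) ab_semigroup_mult_class.mult_ac(1) exp_ge_zero mult_left_mono mult_right_mono zero_le_power2)
      then have "\<bar>q t * \<phi> t ^ j\<bar> * (exp (x * \<phi> t) * \<bar>exp u - (1 + u)\<bar>)
          \<le> \<bar>q t * \<phi> t ^ j\<bar> * (exp ((x / 2) * \<phi> t) * u\<^sup>2)"
        by (intro mult_left_mono) auto
      moreover have "\<bar>q t * \<phi> t ^ j * exp ((x + h) * \<phi> t) - q t * \<phi> t ^ j * exp (x * \<phi> t)
          - h * (q t * \<phi> t ^ Suc j * exp (x * \<phi> t))\<bar>
          = \<bar>q t * \<phi> t ^ j\<bar> * (exp (x * \<phi> t) * \<bar>exp u - (1 + u)\<bar>)"
        unfolding eq by (simp only: abs_mult abs_exp_cancel)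
      moreover have "\<bar>q t * \<phi> t ^ j\<bar> * (exp ((x / 2) * \<phi> t) * u\<^sup>2)
          = h\<^sup>2 * \<bar>q t * \<phi> t ^ (j + 2) * exp ((x / 2) * \<phi> t)\<bar>"
        by (simp add: u_def abs_mult power_mult_distrib power2_eq_square ac_simps)
      ultimately show "\<bar>q t * \<phi> t ^ j * exp ((x + h) * \<phi> t) - q t * \<phi> t ^ j * exp (x * \<phi> t)
          - h * (q t * \<phi> t ^ Suc j * exp (x * \<phi> t))\<bar>
          \<le> h\<^sup>2 * \<bar>q t * \<phi> t ^ (j + 2) * exp ((x / 2) * \<phi> t)\<bar>"
        by linarith
    qed
    also have "\<dots> = h\<^sup>2 * C"
      unfolding C_def by (rule integral_mult_right_zero)
    finally show ?thesis .
  qed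
  have "((\<lambda>h. (?F j (x + h) - ?F j x) / h - ?F (Suc j) x) \<longlongrightarrow> 0) (at 0)"
  proof (rule Lim_null_comparison)
    have "\<forall>\<^sub>F h in at 0. \<bar>h\<bar> < x / 2"
      using x by (auto simp: eventually_at intro!: exI[of _ "x / 2"])
    then show "\<forall>\<^sub>F h in at 0. norm ((?F j (x + h) - ?F j x) / h - ?F (Suc j) x) \<le> \<bar>h\<bar> * C"
      using eventually_neq_at_within[of 0 0 UNIV]
    proof eventually_elim
      case (elim h)
      then have eq: "(?F j (x + h) - ?F j x) / h - ?F (Suc j) x
          = (?F j (x + h) - ?F j x - h * ?F (Suc j) x) / h"
        by (simp add: diff_divide_distrib)
      have "\<bar>(?F j (x + h) - ?F j x) / h - ?F (Suc j) x\<bar>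
          = \<bar>?F j (x + h) - ?F j x - h * ?F (Suc j) x\<bar> / \<bar>h\<bar>"
        unfolding eq by (rule abs_divide)
      also have "\<dots> \<le> \<bar>h\<bar>\<^sup>2 * C / \<bar>h\<bar>"
        using bound[OF elim(1)] by (intro divide_right_mono) auto
      also have "\<dots> = \<bar>h\<bar> * C"
        using elim(2) by (simp add: power2_eq_square del: abs_mult_self_eq)
      finally show ?case by simp
    qed
    show "((\<lambda>h. \<bar>h\<bar> * C) \<longlongrightarrow> 0) (at 0)"
      by (auto intro!: tendsto_eq_intros)
  qed
  then show ?thesis
    unfolding DERIV_def by (subst (asm) LIM_zero_iff) simp
qed

section \<open>Logarithmic integrals over the unit interval\<close>

lemma integrable_lebesgue_on_iff:
  fixes f :: "real \<Rightarrow> real"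
  assumes "S \<in> sets lebesgue"
  shows "integrable (lebesgue_on S) f \<longleftrightarrow> f absolutely_integrable_on S"
  using assms by (simp add: set_integrable_def integrable_restrict_space)

text \<open>The endpoints are left out so that the logarithms and reciprocals below are continuous,
  hence measurable, on the whole space.\<close>

abbreviation unit_measure :: "real measure"
  where "unit_measure \<equiv> lebesgue_on {0<..<1}"

lemma borel_measurable_unit:
  fixes f :: "real \<Rightarrow> real"
  assumes "continuous_on {0<..<1} f"
  shows "f \<in> borel_measurable unit_measure"
  using assms by (intro continuous_imp_measurable_on_sets_lebesgue) auto

text \<open>Passes between the Bochner integral, used for series and for derivatives in a parameter,
  and the gauge integral, used for Beta integrals and changes of variables.\<close>

lemma has_bochner_integral_unit_iff:
  fixes f :: "real \<Rightarrow> real"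
  shows "has_bochner_integral unit_measure f I \<longleftrightarrow>
    f absolutely_integrable_on {0<..<1} \<and> integral {0<..<1} f = I"
  by (auto simp: has_bochner_integral_iff integrable_lebesgue_on_iff lebesgue_integral_eq_integral)

text \<open>The Beta integral with second parameter 1, in Laplace form with weight
  \<open>1 / t\<close> and exponent \<open>ln t\<close>.\<close>

lemma has_bochner_integral_powr:
  assumes "x > 0"
  shows "has_bochner_integral unit_measure (\<lambda>t. 1 / t * exp (x * ln t)) (1 / x)"
proof -
  have "((\<lambda>t. t powr (x - 1) * (1 - t) powr (1 - 1)) has_integral Beta x 1) {0<..<1}"
    using has_integral_Beta_real[of x 1] assms by (simp add: has_integral_Icc_iff_Ioo)
  also have "Beta x 1 = 1 / x"
  proof -
    have "x \<notin> \<int>\<^sub>\<le>\<^sub>0"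
      using assms nonpos_Ints_nonpos[of x] by auto
    then show ?thesis
      using assms Gamma_plus1[of x] by (simp add: Beta_def Gamma_eq_zero_iff)
  qed
  finally have "((\<lambda>t. 1 / t * exp (x * ln t)) has_integral 1 / x) {0<..<1}"
    by (rule has_integral_eq[rotated]) (auto simp: powr_def exp_diff algebra_simps)
  then show ?thesis
    unfolding has_bochner_integral_unit_iff
    by (auto simp: has_integral_iff intro!: nonnegative_absolutely_integrable_1)
qed

text \<open>The symmetric Beta integral, again in Laplace form, now with exponent
  \<open>ln (t * (1 - t))\<close>.\<close>

lemma has_bochner_integral_Beta:
  assumes "x > 0"
  shows "has_bochner_integral unit_measure
    (\<lambda>t. 1 / (t * (1 - t)) * exp (x * ln (t * (1 - t)))) (2 * gamma_ratio x)"
proof -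
  have "((\<lambda>t. t powr (x - 1) * (1 - t) powr (x - 1)) has_integral Beta x x) {0<..<1}"
    using has_integral_Beta_real[of x x] assms by (simp add: has_integral_Icc_iff_Ioo)
  also have "Beta x x = 2 * gamma_ratio x"
    by (simp add: Beta_def gamma_ratio_def power2_eq_square flip: mult_2)
  finally have "((\<lambda>t. 1 / (t * (1 - t)) * exp (x * ln (t * (1 - t)))) has_integral 2 * gamma_ratio x) {0<..<1}"
    by (rule has_integral_eq[rotated]) (auto simp: powr_def exp_diff ln_mult distrib_left left_diff_distrib exp_add)
  then show ?thesis
    unfolding has_bochner_integral_unit_iff
    by (auto simp: has_integral_iff intro!: nonnegative_absolutely_integrable_1)
qed

text \<open>Differentiates the value \<open>1 / x\<close> of the case \<open>j = 0\<close>
  repeatedly in \<open>x\<close>: closed form and integral are derivatives of the same function on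
  the positive half-line, hence equal.\<close>

lemma has_bochner_integral_ln_power:
  assumes "x > 0"
  shows "has_bochner_integral unit_measure (\<lambda>t. 1 / t * ln t ^ j * exp (x * ln t))
    ((-1) ^ j * fact j / x ^ Suc j)"
proof -
  have [measurable]: "(\<lambda>t. 1 / t) \<in> borel_measurable unit_measure"
    "ln \<in> borel_measurable unit_measure"
    by (intro borel_measurable_unit continuous_intros; auto)+
  have int: "integrable unit_measure (\<lambda>t. 1 / t * exp (x * ln t))" if "x > 0" for x
    using has_bochner_integral_powr[OF that] by (simp add: has_bochner_integral_iff)
  have neg: "ln t \<le> 0" if "t \<in> space unit_measure" for t :: real
    using that by simp
  have D: "((\<lambda>x. \<integral>t. 1 / t * ln t ^ j * exp (x * ln t) \<partial>unit_measure) has_field_derivative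
           (\<integral>t. 1 / t * ln t ^ Suc j * exp (x * ln t) \<partial>unit_measure)) (at x)" if "x > 0" for x j
    using int neg that by (intro laplace_moment_has_derivative) auto
  have "(\<integral>t. 1 / t * ln t ^ j * exp (x * ln t) \<partial>unit_measure) = (-1) ^ j * fact j / x ^ Suc j"
    using assms
  proof (induction j arbitrary: x)
    case 0
    then show ?case
      using has_bochner_integral_powr by (simp add: has_bochner_integral_iff)
  next
    case (Suc j)
    have "((\<lambda>x. (-1) ^ j * fact j / x ^ Suc j) has_field_derivative
        (\<integral>t. 1 / t * ln t ^ Suc j * exp (x * ln t) \<partial>unit_measure)) (at x)"
      using D[OF Suc.prems, of j]
      by (rule has_field_derivative_transform_within_open[where S = "{0<..}"]) (use Suc in auto)
    moreover have "((\<lambda>x. (-1) ^ j * fact j / x ^ Suc j) has_field_derivative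
        ((-1) ^ Suc j * fact (Suc j) / x ^ Suc (Suc j))) (at x)"
    proof -
      have "((\<lambda>x. x ^ Suc j) has_field_derivative real (Suc j) * x ^ j) (at x)"
        using DERIV_pow[of "Suc j" x] by simp
      from DERIV_divide[OF DERIV_const this, of "(-1) ^ j * fact j"] show ?thesis
        by (rule DERIV_cong) (use Suc.prems in \<open>auto simp: field_simps\<close>)
    qed
    ultimately show ?case by (rule DERIV_unique)
  qed
  moreover have "integrable unit_measure (\<lambda>t. 1 / t * ln t ^ j * exp (x * ln t))"
    using int neg assms by (intro laplace_moment_integrable) auto
  ultimately show ?thesis by (simp add: has_bochner_integral_iff)
qed

lemma has_bochner_integral_power_ln_power:
  "has_bochner_integral unit_measure (\<lambda>t. t ^ n * ln t ^ j) ((-1) ^ j * fact j / real (Suc n) ^ Suc j)"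
  using has_bochner_integral_ln_power[of "real (Suc n)" j]
  by (rule has_bochner_integral_cong[THEN iffD1, rotated -1])
     (auto simp: exp_of_nat_mult algebra_simps exp_add)

text \<open>Each differentiation in \<open>x\<close> brings down a factor
  \<open>ln (t * (1 - t))\<close>. The integral formula holds only for positive \<open>x\<close>, so
  derivatives are transferred on the open half-line.\<close>

lemma deriv_gamma_ratio:
  assumes "x > 0"
  shows "(deriv ^^ j) gamma_ratio x =
    (\<integral>t. 1 / (t * (1 - t)) * ln (t * (1 - t)) ^ j * exp (x * ln (t * (1 - t))) \<partial>unit_measure) / 2"
  (is "_ = ?G j x / 2")
  and "integrable unit_measure (\<lambda>t. 1 / (t * (1 - t)) * ln (t * (1 - t)) ^ j * exp (x * ln (t * (1 - t))))"
proof -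
  have [measurable]: "(\<lambda>t. 1 / (t * (1 - t))) \<in> borel_measurable unit_measure"
    "(\<lambda>t. ln (t * (1 - t))) \<in> borel_measurable unit_measure"
    by (intro borel_measurable_unit continuous_intros; auto)+
  have int: "integrable unit_measure (\<lambda>t. 1 / (t * (1 - t)) * exp (x * ln (t * (1 - t))))" if "x > 0" for x
    using has_bochner_integral_Beta[OF that] by (simp add: has_bochner_integral_iff)
  have neg: "ln (t * (1 - t)) \<le> 0" if "t \<in> space unit_measure" for t :: real
    using that mult_le_one[of t "1 - t"] by (subst ln_le_zero_iff) auto
  have D: "(?G j has_field_derivative ?G (Suc j) x) (at x)" if "x > 0" for x j
    using int neg that by (intro laplace_moment_has_derivative) auto
  show "integrable unit_measure (\<lambda>t. 1 / (t * (1 - t)) * ln (t * (1 - t)) ^ j * exp (x * ln (t * (1 - t))))"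
    using int neg assms by (intro laplace_moment_integrable) auto
  show "(deriv ^^ j) gamma_ratio x = ?G j x / 2"
    using assms
  proof (induction j arbitrary: x)
    case 0
    then show ?case
      using has_bochner_integral_Beta by (simp add: has_bochner_integral_iff)
  next
    case (Suc j)
    have "((\<lambda>x. ?G j x / 2) has_field_derivative ?G (Suc j) x / 2) (at x)"
      using D[OF Suc.prems] by (rule DERIV_cdivide)
    then have "((deriv ^^ j) gamma_ratio has_field_derivative ?G (Suc j) x / 2) (at x)"
      by (rule has_field_derivative_transform_within_open[where S = "{0<..}"]) (use Suc in auto)
    then show ?case by (simp add: DERIV_imp_deriv)
  qed
qed

section \<open>The double series as a combination of polylogarithms\<close>

text \<open>By the M-test the convergence is uniform up to the boundary circle; later this justifies
  radial limits of such series.\<close>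

lemma power_series_continuous_on_cball:
  fixes a :: "nat \<Rightarrow> complex"
  assumes "summable (\<lambda>n. norm (a n))"
  shows "continuous_on (cball 0 1) (\<lambda>z. \<Sum>n. a n * z ^ n)"
proof (rule uniform_limit_theorem)
  show "uniform_limit (cball 0 1) (\<lambda>n z. \<Sum>i<n. a i * z ^ i) (\<lambda>z. \<Sum>n. a n * z ^ n) sequentially"
    using assms
    by (intro Weierstrass_m_test) (auto simp: norm_mult norm_power mult_left_le power_le_one)
  show "\<forall>\<^sub>F n in sequentially. continuous_on (cball 0 1) (\<lambda>z. \<Sum>i<n. a i * z ^ i)"
    by (intro always_eventually allI continuous_intros)
qed auto

text \<open>
  The terms of index \<open>0\<close> in the next sums vanish because \<open>1 / 0 = 0\<close>. For the same
  reason the summand \<open>i = n\<close> of the convolution does not contribute.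
\<close>

definition zeta_nat :: "nat \<Rightarrow> real"
  where "zeta_nat k = (\<Sum>n. 1 / real n ^ k)"

definition harm_pow :: "nat \<Rightarrow> nat \<Rightarrow> real"
  where "harm_pow k n = (\<Sum>i\<le>n. 1 / real i ^ k)"

definition conv_pow :: "nat \<Rightarrow> real"
  where "conv_pow n = (\<Sum>i\<le>n. 1 / real i ^ 4 * (1 / real (n - i)))"

definition Li_nat :: "nat \<Rightarrow> complex \<Rightarrow> complex"
  where "Li_nat k z = (\<Sum>n. z ^ n / of_nat n ^ k)"

section \<open>Partial fractions for the inner sums\<close>

lemma summable_inverse_nat_power: "k \<ge> 2 \<Longrightarrow> summable (\<lambda>n. 1 / real n ^ k)"
  using inverse_power_summable[of k, where ?'a = real] by (simp add: field_simps)

lemma sums_zeta_tail: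
  assumes "k \<ge> 2"
  shows "(\<lambda>m. 1 / real (Suc m + n) ^ k) sums (zeta_nat k - harm_pow k n)"
proof -
  have "(\<lambda>m. 1 / real m ^ k) sums zeta_nat k"
    using summable_inverse_nat_power[OF assms] by (simp add: zeta_nat_def summable_sums)
  from sums_split_initial_segment[OF this, of "Suc n"] show ?thesis
    by (simp add: harm_pow_def lessThan_Suc_atMost add_ac)
qed

text \<open>Raising the shift from \<open>n\<close> to \<open>Suc n\<close> adds a telescoping
  series with value \<open>1 / real (Suc n)\<close>.\<close>

lemma sums_harmonic_difference:
  "(\<lambda>m. 1 / real (Suc m) - 1 / real (Suc m + n)) sums harm_pow 1 n"
proof (induction n)
  case 0
  then show ?case by (simp add: harm_pow_def)
next
  case (Suc n)
  have "(\<lambda>m. 1 / real (m + Suc n)) \<longlonglongrightarrow> 0"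
    by real_asymp
  from sums_add[OF Suc telescope_sums'[OF this]] show ?case
    by (simp add: harm_pow_def add_ac)
qed

text \<open>Iterating \<open>1 / (m N) = (1 / m - 1 / N) / n\<close> for \<open>N = m + n\<close>.\<close>

lemma sums_inverse_shifted_power4:
  assumes "n > 0"
  shows "(\<lambda>m. 1 / (real (Suc m) * real (Suc m + n) ^ 4)) sums
    (harm_pow 1 n / real n ^ 4 - (zeta_nat 2 - harm_pow 2 n) / real n ^ 3
      - (zeta_nat 3 - harm_pow 3 n) / real n ^ 2 - (zeta_nat 4 - harm_pow 4 n) / real n)"
proof -
  have pf: "1 / (m * N ^ 4) = (1 / m - 1 / N) / n ^ 4 - 1 / N ^ 2 / n ^ 3
      - 1 / N ^ 3 / n ^ 2 - 1 / N ^ 4 / n"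
    if "m > 0" "n > 0" "N = m + n" for m n N :: real
  proof -
    have [simp]: "m \<noteq> 0" "n \<noteq> 0" "N \<noteq> 0" using that by auto
    have m: "m = N - n" using that by simp
    show ?thesis
      by (simp add: divide_simps) (simp add: m algebra_simps power2_eq_square power3_eq_cube power4_eq_xxxx)
  qed
  have "(\<lambda>m. (1 / real (Suc m) - 1 / real (Suc m + n)) / real n ^ 4
      - 1 / real (Suc m + n) ^ 2 / real n ^ 3 - 1 / real (Suc m + n) ^ 3 / real n ^ 2
      - 1 / real (Suc m + n) ^ 4 / real n) sums
    (harm_pow 1 n / real n ^ 4 - (zeta_nat 2 - harm_pow 2 n) / real n ^ 3
      - (zeta_nat 3 - harm_pow 3 n) / real n ^ 2 - (zeta_nat 4 - harm_pow 4 n) / real n)"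
    by (intro sums_diff sums_divide sums_zeta_tail sums_harmonic_difference) auto
  then show ?thesis
    using assms by (subst (asm) pf[symmetric]) auto
qed

text \<open>Partial fractions in \<open>i\<close> and \<open>n - i\<close>. The reflection of
  \<open>i\<close> to \<open>n - i\<close> doubles the harmonic sum, and the subtracted powers of
  \<open>1 / real n\<close> remove the summand \<open>i = n\<close> from each
  \<open>harm_pow\<close>.\<close>

lemma conv_pow_eq:
  "conv_pow n = 2 * (harm_pow 1 n - 1 / real n) / real n ^ 4
     + (harm_pow 2 n - 1 / real n ^ 2) / real n ^ 3
     + (harm_pow 3 n - 1 / real n ^ 3) / real n ^ 2 + (harm_pow 4 n - 1 / real n ^ 4) / real n"
proof (cases n)
  case 0
  then show ?thesis by (simp add: conv_pow_def harm_pow_def)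
next
  case (Suc k)
  have pf: "1 / q ^ 4 * (1 / p) = (1 / p + 1 / q) / n ^ 4 + 1 / q ^ 2 / n ^ 3
      + 1 / q ^ 3 / n ^ 2 + 1 / q ^ 4 / n"
    if "p > 0" "q > 0" "n = p + q" for p q n :: real
  proof -
    have [simp]: "p \<noteq> 0" "q \<noteq> 0" "n \<noteq> 0" using that by auto
    have p: "p = n - q" using that by simp
    show ?thesis
      by (simp add: divide_simps) (simp add: p algebra_simps power2_eq_square power3_eq_cube power4_eq_xxxx)
  qed
  \<comment> \<open>The ends \<open>i = 0\<close> and \<open>i = n\<close> are separated because a
    denominator vanishes there and the partial fractions fail.\<close>
  have split: "(\<Sum>i\<le>n. f i) = f 0 + (\<Sum>i = 1..k. f i) + f n" for f :: "nat \<Rightarrow> real"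
    using Suc by (simp add: atMost_atLeast0 sum.atLeast_Suc_atMost)
  have harm: "harm_pow j n - 1 / real n ^ j = (\<Sum>i = 1..k. 1 / real i ^ j)" if "j > 0" for j
    using that by (simp add: harm_pow_def split)
  have "conv_pow n = (\<Sum>i = 1..k. 1 / real i ^ 4 * (1 / real (n - i)))"
    unfolding conv_pow_def split by simp
  also have "\<dots> = (\<Sum>i = 1..k. (1 / real (n - i) + 1 / real i) / real n ^ 4 + 1 / real i ^ 2 / real n ^ 3
      + 1 / real i ^ 3 / real n ^ 2 + 1 / real i ^ 4 / real n)"
    using Suc by (intro sum.cong refl pf) auto
  also have "\<dots> = ((\<Sum>i = 1..k. 1 / real (n - i)) + (\<Sum>i = 1..k. 1 / real i)) / real n ^ 4
      + (\<Sum>i = 1..k. 1 / real i ^ 2) / real n ^ 3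
      + (\<Sum>i = 1..k. 1 / real i ^ 3) / real n ^ 2 + (\<Sum>i = 1..k. 1 / real i ^ 4) / real n"
    by (simp only: sum.distrib sum_divide_distrib add_divide_distrib)
  also have "(\<Sum>i = 1..k. 1 / real (n - i)) = (\<Sum>i = 1..k. 1 / real i)"
    using Suc by (intro sum.reindex_bij_witness[of _ "\<lambda>i. n - i" "\<lambda>i. n - i"]) auto
  finally show ?thesis
    using harm[of 1] harm[of 2] harm[of 3] harm[of 4] by simp
qed

text \<open>Regroups the value into coefficients of known series: \<open>conv_pow\<close> belongs to
  the product of Li_4 and Li_1, and \<open>(harm_pow 1 n - 1 / real n) / real n ^ 4\<close> to
  Li_{4,1}. One copy of the latter survives inside \<open>conv_pow\<close>; the term
  \<open>4 / real n ^ 5\<close> cancels the four corrections that remain from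
  \<open>conv_pow_eq\<close>.\<close>

lemma sums_inverse_shifted_power4':
  assumes "n > 0"
  shows "(\<lambda>m. 1 / (real (Suc m) * real (Suc m + n) ^ 4)) sums
    (conv_pow n - zeta_nat 4 / real n - zeta_nat 3 / real n ^ 2 - zeta_nat 2 / real n ^ 3
      - (harm_pow 1 n - 1 / real n) / real n ^ 4 + 4 / real n ^ 5)"
proof -
  have "conv_pow n - zeta_nat 4 / real n - zeta_nat 3 / real n ^ 2 - zeta_nat 2 / real n ^ 3
      - (harm_pow 1 n - 1 / real n) / real n ^ 4 + 4 / real n ^ 5
    = harm_pow 1 n / real n ^ 4 - (zeta_nat 2 - harm_pow 2 n) / real n ^ 3
      - (zeta_nat 3 - harm_pow 3 n) / real n ^ 2 - (zeta_nat 4 - harm_pow 4 n) / real n"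
    using assms by (simp add: conv_pow_eq field_simps eval_nat_numeral)
  then show ?thesis
    using sums_inverse_shifted_power4[OF assms] by (simp only:)
qed

text \<open>Cauchy product of Li_4 with \<open>- Ln (1 - z)\<close>. The multiple
  \<open>zeta_nat 4\<close> of the logarithm is subtracted coefficientwise because the difference
  has absolutely summable coefficients, which allows the passage to the boundary.\<close>

lemma conv_pow_power_series:
  assumes "norm z < 1"
  shows "(\<lambda>n. of_real (conv_pow n - zeta_nat 4 / real n) * z ^ n) sums
    (- Ln (1 - z) * (Li_nat 4 z - of_real (zeta_nat 4)))"
proof -
  have sumpow: "summable (\<lambda>n. norm (z ^ n / of_nat n ^ k))" for k
  proof (rule summable_comparison_test')
    show "summable (\<lambda>n. norm z ^ n)" using assms by (simp add: summable_geometric)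
    show "norm (norm (z ^ n / of_nat n ^ k)) \<le> norm z ^ n" if "n \<ge> 0" for n
    proof (cases "n = 0")
      case False
      then have "1 \<le> real n ^ k" by (intro one_le_power) auto
      then have "norm z ^ n * 1 \<le> norm z ^ n * real n ^ k" by (intro mult_left_mono) auto
      then show ?thesis
        by (simp add: norm_divide norm_power divide_le_eq)
    qed (auto simp: power_0_left)
  qed
  have ln: "(\<lambda>n. z ^ n / of_nat n) sums (- Ln (1 - z))"
    using sums_minus[OF Ln_series'[of "- z"]] assms by simp
  have "(\<lambda>n. \<Sum>i\<le>n. z ^ i / of_nat i ^ 4 * (z ^ (n - i) / of_nat (n - i))) sums
    (Li_nat 4 z * (- Ln (1 - z)))"
    using Cauchy_product_sums[OF sumpow[of 4] sumpow[of 1]] ln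
    by (simp add: Li_nat_def sums_iff)
  also have "(\<lambda>n. \<Sum>i\<le>n. z ^ i / of_nat i ^ 4 * (z ^ (n - i) / of_nat (n - i)))
      = (\<lambda>n. of_real (conv_pow n) * z ^ n)"
  proof
    fix n
    have "z ^ i / of_nat i ^ 4 * (z ^ (n - i) / of_nat (n - i))
        = of_real (1 / real i ^ 4 * (1 / real (n - i))) * z ^ n" if "i \<le> n" for i
    proof -
      have "z ^ n = z ^ i * z ^ (n - i)" using that by (simp flip: power_add)
      then show ?thesis by simp
    qed
    then show "(\<Sum>i\<le>n. z ^ i / of_nat i ^ 4 * (z ^ (n - i) / of_nat (n - i)))
      = of_real (conv_pow n) * z ^ n"
      unfolding conv_pow_def of_real_sum sum_distrib_right by (intro sum.cong) auto
  qed
  finally have "(\<lambda>n. of_real (conv_pow n) * z ^ n - of_real (zeta_nat 4) * (z ^ n / of_nat n)) sums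
    (Li_nat 4 z * (- Ln (1 - z)) - of_real (zeta_nat 4) * (- Ln (1 - z)))"
    using ln by (intro sums_diff sums_mult)
  then show ?thesis by (simp add: algebra_simps)
qed

text \<open>The coefficient of \<open>\<omega>^n\<close> in the double series. At
  \<open>n = 0\<close> it is the series of \<open>1 / m^5\<close>, which does not belong there; that
  index is set to zero wherever a sum starts at 0.\<close>

definition shifted_sum :: "nat \<Rightarrow> real"
  where "shifted_sum n = (\<Sum>m. 1 / (real (Suc m) * real (Suc m + n) ^ 4))"

lemma shifted_sum_eq:
  assumes "n > 0"
  shows "shifted_sum n = conv_pow n - zeta_nat 4 / real n - zeta_nat 3 / real n ^ 2
    - zeta_nat 2 / real n ^ 3 - (harm_pow 1 n - 1 / real n) / real n ^ 4 + 4 / real n ^ 5"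
  using sums_inverse_shifted_power4'[OF assms] by (simp add: shifted_sum_def sums_iff)

text \<open>In \<open>(m + n)^4\<close> one factor is bounded below by \<open>m\<close> and three by
  \<open>n\<close>. The decay in \<open>n\<close> makes the outer series absolutely
  convergent.\<close>

lemma shifted_sum_bounds:
  assumes "n > 0"
  shows "0 \<le> shifted_sum n" "shifted_sum n \<le> zeta_nat 2 / real n ^ 3"
proof -
  have sm: "summable (\<lambda>m. 1 / (real (Suc m) * real (Suc m + n) ^ 4))"
    using sums_inverse_shifted_power4[OF assms] by (simp add: sums_iff)
  show "0 \<le> shifted_sum n"
    unfolding shifted_sum_def by (intro suminf_nonneg sm) auto
  have "(\<lambda>m. 1 / real (Suc m) ^ 2) sums zeta_nat 2"
    using sums_zeta_tail[of 2 0] by (simp add: harm_pow_def)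
  from sums_divide[OF this, of "real n ^ 3"]
  have Z: "(\<lambda>m. 1 / real (Suc m) ^ 2 / real n ^ 3) sums (zeta_nat 2 / real n ^ 3)" .
  show "shifted_sum n \<le> zeta_nat 2 / real n ^ 3"
    unfolding shifted_sum_def
  proof (rule sums_le[OF _ summable_sums[OF sm] Z])
    fix m
    have "real (Suc m) * real n ^ 3 \<le> real (Suc m + n) * real (Suc m + n) ^ 3"
      by (intro mult_mono power_mono) auto
    then have "real (Suc m) * (real (Suc m) * real n ^ 3) \<le> real (Suc m) * real (Suc m + n) ^ 4"
      by (intro mult_left_mono) (auto simp: eval_nat_numeral)
    then show "1 / (real (Suc m) * real (Suc m + n) ^ 4) \<le> 1 / real (Suc m) ^ 2 / real n ^ 3"
      using assms by (auto simp: power2_eq_square mult.assoc intro!: divide_left_mono mult_pos_pos)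
  qed
qed

text \<open>The crude upper bound suffices: divided by \<open>n^4\<close> it leaves the summable
  \<open>1 / n^3\<close>.\<close>

lemma harm_pow_1_bounds:
  "0 \<le> harm_pow 1 n - 1 / real n" "harm_pow 1 n - 1 / real n \<le> real n"
proof -
  have "(\<Sum>i\<in>{..n} - {n}. 1 / real i ^ 1) = harm_pow 1 n - 1 / real n"
    unfolding harm_pow_def by (subst sum_diff1) auto
  moreover have "0 \<le> (\<Sum>i\<in>{..n} - {n}. 1 / real i ^ 1)" 
    by (intro sum_nonneg) auto
  moreover have "(\<Sum>i\<in>{..n} - {n}. 1 / real i ^ 1) \<le> (\<Sum>i\<in>{..n} - {n}. 1)"
  proof (rule sum_mono)
    fix i show "1 / real i ^ 1 \<le> 1" by (cases i) auto
  qed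
  ultimately show "0 \<le> harm_pow 1 n - 1 / real n" "harm_pow 1 n - 1 / real n \<le> real n"
    by auto
qed

lemma summable_harm_pow: "summable (\<lambda>n. \<bar>(harm_pow 1 n - 1 / real n) / real n ^ 4\<bar>)"
proof (rule summable_comparison_test')
  show "summable (\<lambda>n. 1 / real n ^ 3)" by (rule summable_inverse_nat_power) simp
  show "norm \<bar>(harm_pow 1 n - 1 / real n) / real n ^ 4\<bar> \<le> 1 / real n ^ 3" if "n \<ge> 0" for n
    using harm_pow_1_bounds[of n] by (cases "n = 0") (auto simp: abs_if divide_simps eval_nat_numeral)
qed

lemma summable_shifted_sum: "summable (\<lambda>n. \<bar>if n = 0 then 0 else shifted_sum n\<bar>)"
proof (rule summable_comparison_test')
  show "summable (\<lambda>n. zeta_nat 2 * (1 / real n ^ 3))"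
    by (intro summable_mult summable_inverse_nat_power) simp
  show "norm \<bar>if n = 0 then 0 else shifted_sum n\<bar> \<le> zeta_nat 2 * (1 / real n ^ 3)" if "n \<ge> 0" for n
    using shifted_sum_bounds[of n] by auto
qed

text \<open>Solving \<open>shifted_sum_eq\<close> for this difference expresses it through terms
  already known to be absolutely summable; at \<open>n = 0\<close> it vanishes.\<close>

lemma summable_conv_pow: "summable (\<lambda>n. \<bar>conv_pow n - zeta_nat 4 / real n\<bar>)"
proof (rule summable_comparison_test')
  have zeta: "summable (\<lambda>n. \<bar>c / real n ^ k\<bar>)" if "k \<ge> 2" for k c
    using summable_mult[OF summable_inverse_nat_power[OF that], of "\<bar>c\<bar>"] by simp
  show "summable (\<lambda>n. \<bar>if n = 0 then 0 else shifted_sum n\<bar> + \<bar>zeta_nat 3 / real n ^ 2\<bar>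
      + \<bar>zeta_nat 2 / real n ^ 3\<bar> + \<bar>(harm_pow 1 n - 1 / real n) / real n ^ 4\<bar> + \<bar>4 / real n ^ 5\<bar>)"
    by (intro summable_add summable_shifted_sum summable_harm_pow zeta) auto
  show "norm \<bar>conv_pow n - zeta_nat 4 / real n\<bar>
      \<le> \<bar>if n = 0 then 0 else shifted_sum n\<bar> + \<bar>zeta_nat 3 / real n ^ 2\<bar>
      + \<bar>zeta_nat 2 / real n ^ 3\<bar> + \<bar>(harm_pow 1 n - 1 / real n) / real n ^ 4\<bar> + \<bar>4 / real n ^ 5\<bar>"
    if "n \<ge> 0" for n
  proof (cases "n = 0")
    case False
    then have eq: "conv_pow n - zeta_nat 4 / real n = shifted_sum n + zeta_nat 3 / real n ^ 2
        + zeta_nat 2 / real n ^ 3 + (harm_pow 1 n - 1 / real n) / real n ^ 4 - 4 / real n ^ 5"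
      using shifted_sum_eq[of n] by simp
    show ?thesis
      unfolding eq real_norm_def using False by (simp only: if_False)
  qed (simp add: conv_pow_def)
qed

section \<open>Boundary values on the closed unit disc\<close>

lemma Li_nat_sums:
  assumes "norm z \<le> 1" "k \<ge> 2"
  shows "(\<lambda>n. z ^ n / of_nat n ^ k) sums Li_nat k z"
  unfolding Li_nat_def
proof (intro summable_sums summable_norm_cancel[of "\<lambda>n. z ^ n / of_nat n ^ k"])
  show "summable (\<lambda>n. norm (z ^ n / of_nat n ^ k))"
    by (rule summable_comparison_test'[OF summable_inverse_nat_power[OF assms(2)]])
       (use assms in \<open>auto simp: norm_divide norm_power power_le_one intro!: divide_right_mono\<close>)
qed

text \<open>Radial limit of the identity in the open disc: the series is continuous on the closed
  disc, and the logarithm is continuous away from \<open>z = 1\<close>.\<close>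

lemma conv_pow_power_series_cball:
  assumes "norm z \<le> 1" "z \<noteq> 1"
  shows "(\<lambda>n. of_real (conv_pow n - zeta_nat 4 / real n) * z ^ n) sums
    (- Ln (1 - z) * (Li_nat 4 z - of_real (zeta_nat 4)))"
proof -
  define D where "D = (\<lambda>z. \<Sum>n. complex_of_real (conv_pow n - zeta_nat 4 / real n) * z ^ n)"
  have sm: "summable (\<lambda>n. norm (complex_of_real (conv_pow n - zeta_nat 4 / real n)))"
    using summable_conv_pow by (simp only: norm_of_real)
  \<comment> \<open>Points on the radius through \<open>z\<close>, strictly inside the disc and
    tending to \<open>z\<close>.\<close>
  define w where "w = (\<lambda>k. of_real (1 - 1 / real (Suc k)) * z)"
  have "(\<lambda>k. 1 - 1 / real (Suc k)) \<longlonglongrightarrow> 1" by real_asymp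
  from tendsto_mult[OF tendsto_of_real[OF this] tendsto_const[of z]]
  have w: "w \<longlonglongrightarrow> z" by (simp add: w_def)
  have w1: "norm (w k) < 1" for k
  proof -
    have "norm (w k) = (1 - 1 / real (Suc k)) * norm z"
      unfolding w_def norm_mult norm_of_real by simp
    also have "\<dots> \<le> (1 - 1 / real (Suc k)) * 1" using assms by (intro mult_left_mono) auto
    also have "\<dots> < 1" by simp
    finally show ?thesis .
  qed
  have cont: "(\<lambda>k. f (w k)) \<longlonglongrightarrow> f z" if "continuous_on (cball 0 1) f" for f :: "complex \<Rightarrow> complex"
    using w1 assms
    by (intro continuous_on_tendsto_compose[OF that w] always_eventually allI) (auto intro: less_imp_le)
  have "(\<lambda>k. D (w k)) \<longlonglongrightarrow> D z"
    unfolding D_def by (rule cont power_series_continuous_on_cball sm)+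
  moreover have "(\<lambda>k. D (w k)) \<longlonglongrightarrow> - Ln (1 - z) * (Li_nat 4 z - of_real (zeta_nat 4))"
  proof -
    have "continuous_on (cball 0 1) (\<lambda>z. \<Sum>n. (1 / of_nat n ^ 4) * z ^ n :: complex)"
      using summable_inverse_nat_power[of 4]
      by (intro power_series_continuous_on_cball) (simp add: norm_divide norm_power)
    then have "(\<lambda>k. Li_nat 4 (w k)) \<longlonglongrightarrow> Li_nat 4 z"
      by (intro cont) (simp add: Li_nat_def[abs_def])
    \<comment> \<open>In the closed disc \<open>Re z \<le> 1\<close>, so \<open>1 - z\<close> can
      meet the branch cut only at its end 0, that is at \<open>z = 1\<close>.\<close>
    moreover have "1 - z \<notin> \<real>\<^sub>\<le>\<^sub>0"
    proof
      assume "1 - z \<in> \<real>\<^sub>\<le>\<^sub>0"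
      then have "Re z \<ge> 1" "Im z = 0" by (auto simp: complex_nonpos_Reals_iff)
      moreover have "Re z \<le> 1" using assms(1) complex_Re_le_cmod[of z] by linarith
      ultimately show False using \<open>z \<noteq> 1\<close> by (simp add: complex_eq_iff)
    qed
    ultimately have "(\<lambda>k. - Ln (1 - w k) * (Li_nat 4 (w k) - of_real (zeta_nat 4)))
        \<longlonglongrightarrow> - Ln (1 - z) * (Li_nat 4 z - of_real (zeta_nat 4))"
      by (intro tendsto_intros w)
    then show ?thesis
      using conv_pow_power_series[OF w1] by (simp add: D_def sums_iff)
  qed
  ultimately have "D z = - Ln (1 - z) * (Li_nat 4 z - of_real (zeta_nat 4))"
    by (rule LIMSEQ_unique)
  moreover have "summable (\<lambda>n. complex_of_real (conv_pow n - zeta_nat 4 / real n) * z ^ n)"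
  proof (rule summable_comparison_test'[OF sm])
    show "norm (complex_of_real (conv_pow n - zeta_nat 4 / real n) * z ^ n)
      \<le> norm (complex_of_real (conv_pow n - zeta_nat 4 / real n))" for n
      using assms by (simp add: norm_mult norm_power mult_left_le power_le_one)
  qed
  ultimately show ?thesis by (simp add: D_def sums_iff)
qed

text \<open>Summing the pairs row by row: for fixed \<open>n1 = n\<close> the reciprocals of
  \<open>n2 < n\<close> add up to the harmonic number of index \<open>n - 1\<close>, which is
  \<open>harm_pow 1 n - 1 / real n\<close>.\<close>

lemma Li41_sums:
  assumes "norm z \<le> 1"
  shows "(\<lambda>n. of_real ((harm_pow 1 n - 1 / real n) / real n ^ 4) * z ^ n) sums Li41 z"
proof -
  define f where "f = (\<lambda>(n1, n2). z ^ n1 / (of_nat n1 ^ 4 * of_nat n2))"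
  define c where "c = (\<lambda>n. (harm_pow 1 n - 1 / real n) / real n ^ 4)"
  have set_eq: "{(n1, n2). n1 > n2 \<and> n2 \<ge> 1} = Sigma (UNIV :: nat set) (\<lambda>n. {1..<n})"
    by auto
  have harm: "(\<Sum>i = 1..<n. 1 / real i) = harm_pow 1 n - 1 / real n" for n
  proof -
    have "{..n} = insert 0 (insert n {1..<n})" by auto
    then show ?thesis by (cases "n = 0") (simp_all add: harm_pow_def)
  qed
  have inner: "(\<Sum>y\<in>{1..<n}. f (n, y)) = of_real (c n) * z ^ n" for n
  proof -
    have "(\<Sum>y\<in>{1..<n}. f (n, y)) = (z ^ n / of_nat n ^ 4) * of_real (\<Sum>i = 1..<n. 1 / real i)"
      by (simp add: f_def sum_distrib_left)
    then show ?thesis unfolding harm by (simp add: c_def)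
  qed
  \<comment> \<open>The same row sums with norms give the absolute summability that permits the
    summation by rows.\<close>
  have inner_norm: "(\<Sum>y\<in>{1..<n}. norm (f (n, y))) = c n * norm z ^ n" for n
  proof -
    have "(\<Sum>y\<in>{1..<n}. norm (f (n, y))) = (norm z ^ n / real n ^ 4) * (\<Sum>i = 1..<n. 1 / real i)"
      by (simp add: f_def sum_distrib_left norm_divide norm_mult norm_power)
    then show ?thesis unfolding harm by (simp add: c_def)
  qed
  have smn: "summable (\<lambda>n. norm (c n * norm z ^ n))"
  proof (rule summable_comparison_test'[OF summable_harm_pow])
    fix n
    have "\<bar>c n\<bar> * norm z ^ n \<le> \<bar>c n\<bar>"
      using assms by (intro mult_left_le power_le_one) auto
    then show "norm (norm (c n * norm z ^ n)) \<le> \<bar>(harm_pow 1 n - 1 / real n) / real n ^ 4\<bar>"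
      by (simp add: c_def abs_mult)
  qed
  have "(\<lambda>p. norm (f p)) summable_on (Sigma UNIV (\<lambda>n. {1..<n}))"
    unfolding Infinite_Sum.abs_summable_on_Sigma_iff
    using norm_summable_imp_summable_on[of "\<lambda>n. norm (c n * norm z ^ n)"] smn
    by (auto simp: inner_norm simp del: One_nat_def)
  then have "f summable_on (Sigma UNIV (\<lambda>n. {1..<n}))"
    by (rule Infinite_Sum.abs_summable_summable)
  then have "(f has_sum Li41 z) (Sigma UNIV (\<lambda>n. {1..<n}))"
    unfolding Li41_def f_def set_eq by (rule has_sum_infsum)
  then have "((\<lambda>n. of_real (c n) * z ^ n) has_sum Li41 z) UNIV"
    by (rule has_sum_SigmaD) (metis inner has_sum_finite finite_atLeastLessThan)
  then show ?thesis unfolding c_def by (rule has_sum_imp_sums)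
qed

text \<open>Coefficient by coefficient this is \<open>shifted_sum_eq\<close>; every series on the
  right has constant term 0.\<close>

lemma shifted_sum_power_series:
  assumes "norm z \<le> 1" "z \<noteq> 1"
  shows "(\<lambda>n. of_real (if n = 0 then 0 else shifted_sum n) * z ^ n) sums
    (- Ln (1 - z) * (Li_nat 4 z - of_real (zeta_nat 4)) - of_real (zeta_nat 3) * Li_nat 2 z
     - of_real (zeta_nat 2) * Li_nat 3 z - Li41 z + 4 * Li_nat 5 z)"
proof -
  have "(\<lambda>n. of_real (conv_pow n - zeta_nat 4 / real n) * z ^ n
      - of_real (zeta_nat 3) * (z ^ n / of_nat n ^ 2) - of_real (zeta_nat 2) * (z ^ n / of_nat n ^ 3)
      - of_real ((harm_pow 1 n - 1 / real n) / real n ^ 4) * z ^ n + 4 * (z ^ n / of_nat n ^ 5)) sums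
    (- Ln (1 - z) * (Li_nat 4 z - of_real (zeta_nat 4)) - of_real (zeta_nat 3) * Li_nat 2 z
     - of_real (zeta_nat 2) * Li_nat 3 z - Li41 z + 4 * Li_nat 5 z)"
    using assms
    by (intro sums_add sums_diff sums_mult conv_pow_power_series_cball Li_nat_sums Li41_sums) auto
  moreover have "of_real (conv_pow n - zeta_nat 4 / real n) * z ^ n
      - of_real (zeta_nat 3) * (z ^ n / of_nat n ^ 2) - of_real (zeta_nat 2) * (z ^ n / of_nat n ^ 3)
      - of_real ((harm_pow 1 n - 1 / real n) / real n ^ 4) * z ^ n + 4 * (z ^ n / of_nat n ^ 5)
      = of_real (if n = 0 then 0 else shifted_sum n) * z ^ n" for n
    by (cases "n = 0") (simp_all add: conv_pow_def harm_pow_def shifted_sum_eq algebra_simps)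
  ultimately show ?thesis by (simp only:)
qed

section \<open>Polylogarithms on the unit circle\<close>

lemma Li_nat_cis_sums:
  assumes "k \<ge> 2"
  shows "(\<lambda>n. cos (real n * x) / real n ^ k) sums Re (Li_nat k (cis x))"
    and "(\<lambda>n. sin (real n * x) / real n ^ k) sums Im (Li_nat k (cis x))"
proof -
  have "(\<lambda>n. cis x ^ n / of_nat n ^ k) sums Li_nat k (cis x)"
    using assms by (intro Li_nat_sums) auto
  then have *: "(\<lambda>n. cis (real n * x) / of_real (real n ^ k)) sums Li_nat k (cis x)"
    by (simp add: Complex.DeMoivre)
  show "(\<lambda>n. cos (real n * x) / real n ^ k) sums Re (Li_nat k (cis x))"
    using sums_Re[OF *] by (simp only: Re_divide_of_real cis.simps)
  show "(\<lambda>n. sin (real n * x) / real n ^ k) sums Im (Li_nat k (cis x))"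
    using sums_Im[OF *] by (simp only: Im_divide_of_real cis.simps)
qed

lemma Li_nat_cis_0: "k \<ge> 2 \<Longrightarrow> Re (Li_nat k (cis 0)) = zeta_nat k" "k \<ge> 2 \<Longrightarrow> Im (Li_nat k (cis 0)) = 0"
  using Li_nat_cis_sums[of k 0] by (simp_all add: zeta_nat_def sums_iff)

lemma zeta_nat_2: "zeta_nat 2 = pi\<^sup>2 / 6"
  using inverse_squares_sums sums_zeta_tail[of 2 0]
  by (simp add: harm_pow_def sums_iff add_ac)

text \<open>Termwise differentiation: the differentiated series is dominated by
  \<open>1 / n^k\<close>. Starting from Re Li_2 this climbs to the orders 3, 4 and 5.\<close>

lemma Li_nat_cis_has_derivative:
  assumes "k \<ge> 2"
  shows "((\<lambda>x. Im (Li_nat (Suc k) (cis x))) has_field_derivative Re (Li_nat k (cis x))) (at x)"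
    and "((\<lambda>x. Re (Li_nat (Suc k) (cis x))) has_field_derivative - Im (Li_nat k (cis x))) (at x)"
proof -
  have unif: "uniformly_convergent_on UNIV (\<lambda>n x. \<Sum>i<n. cos (real i * x) / real i ^ k)"
    using assms by (intro Weierstrass_m_test'[OF _ summable_inverse_nat_power[of k]]) (auto simp: divide_right_mono)
  have "((\<lambda>x. \<Sum>n. sin (real n * x) / real n ^ Suc k) has_field_derivative
      (\<Sum>n. cos (real n * x) / real n ^ k)) (at x)"
  proof (rule has_field_derivative_series'(2)[OF convex_UNIV _ unif, where ?x0.0 = 0])
    show "((\<lambda>x. sin (real n * x) / real n ^ Suc k) has_field_derivative
        cos (real n * x) / real n ^ k) (at x within UNIV)" for n x
      using assms by (cases "n = 0") (auto intro!: derivative_eq_intros)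
  qed simp_all
  then show "((\<lambda>x. Im (Li_nat (Suc k) (cis x))) has_field_derivative Re (Li_nat k (cis x))) (at x)"
    using Li_nat_cis_sums[of k] Li_nat_cis_sums[of "Suc k"] assms by (simp add: sums_iff)
  have unif': "uniformly_convergent_on UNIV (\<lambda>n x. \<Sum>i<n. - sin (real i * x) / real i ^ k)"
    using assms by (intro Weierstrass_m_test'[OF _ summable_inverse_nat_power[of k]]) (auto simp: divide_right_mono)
  have "summable (\<lambda>n. cos (real n * 0) / real n ^ Suc k)"
    using Li_nat_cis_sums(1)[of "Suc k" 0] assms by (simp add: sums_iff)
  then have "((\<lambda>x. \<Sum>n. cos (real n * x) / real n ^ Suc k) has_field_derivative
      (\<Sum>n. - sin (real n * x) / real n ^ k)) (at x)"
  proof (intro has_field_derivative_series'(2)[OF convex_UNIV _ unif', where ?x0.0 = 0])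
    show "((\<lambda>x. cos (real n * x) / real n ^ Suc k) has_field_derivative
        - sin (real n * x) / real n ^ k) (at x within UNIV)" for n x
      using assms by (cases "n = 0") (auto intro!: derivative_eq_intros)
  qed simp_all
  then show "((\<lambda>x. Re (Li_nat (Suc k) (cis x))) has_field_derivative - Im (Li_nat k (cis x))) (at x)"
    using Li_nat_cis_sums[of k x] Li_nat_cis_sums[of "Suc k"] assms
    by (simp add: sums_iff suminf_minus)
qed

text \<open>The polar form is \<open>1 - cis x = 2 * sin (x / 2) * cis ((x - pi) / 2)\<close>, with
  positive radius and an angle between \<open>- pi / 2\<close> and \<open>pi / 2\<close>, hence
  principal.\<close>

lemma Ln_1_minus_cis:
  assumes "0 < x" "x < 2 * pi"
  shows "Ln (1 - cis x) = Complex (ln (2 * sin (x / 2))) ((x - pi) / 2)"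
proof -
  have pos: "sin (x / 2) > 0" using assms by (intro sin_gt_zero) auto
  have "exp (Complex (ln (2 * sin (x / 2))) ((x - pi) / 2))
      = of_real (2 * sin (x / 2)) * cis ((x - pi) / 2)"
    using pos by (simp add: exp_eq_polar)
  also have "\<dots> = 1 - cis x"
  proof -
    have "cos ((x - pi) / 2) = sin (x / 2)" "sin ((x - pi) / 2) = - cos (x / 2)"
      by (simp_all add: diff_divide_distrib cos_diff sin_diff)
    moreover have "cos x = 1 - 2 * sin (x / 2) ^ 2" "sin x = 2 * sin (x / 2) * cos (x / 2)"
      using cos_double_sin[of "x / 2"] sin_double[of "x / 2"] by simp_all
    ultimately show ?thesis
      by (simp add: complex_eq_iff power2_eq_square)
  qed
  finally have "1 - cis x = exp (Complex (ln (2 * sin (x / 2))) ((x - pi) / 2))" ..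
  then show ?thesis using assms by simp
qed

text \<open>
  The series has no uniformly convergent derivative up to \<open>x = 0\<close>, so it is integrated on the
  circles of radius \<open>r < 1\<close>, where the derivative \<open>Im (Ln (1 - r cis x))\<close> is bounded by \<open>pi\<close>.
\<close>

lemma Re_Li_nat_2_cis:
  assumes "0 \<le> x" "x < 2 * pi"
  shows "Re (Li_nat 2 (cis x)) = pi\<^sup>2 / 6 - pi * x / 2 + x\<^sup>2 / 4"
proof -
  define r where "r = (\<lambda>k. 1 - 1 / real (Suc k))"
  define z where "z = (\<lambda>k t. of_real (r k) * cis t)"
  have r: "0 \<le> r k" "r k < 1" for k by (auto simp: r_def)
  have rlim: "r \<longlonglongrightarrow> 1" unfolding r_def by real_asymp
  have zlim: "(\<lambda>k. z k t) \<longlonglongrightarrow> cis t" for t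
    unfolding z_def using tendsto_mult[OF tendsto_of_real[OF rlim] tendsto_const[of "cis t"]] by simp
  have zn: "norm (z k t) < 1" for k t using r by (simp add: z_def norm_mult)
  have powz: "z k t ^ n = of_real (r k ^ n) * cis (real n * t)" for k t n
    by (simp add: z_def power_mult_distrib Complex.DeMoivre)
  have Ln_ne: "1 - z k t \<noteq> 0" for k t using zn[of k t] by auto
  have Li2: "(\<lambda>n. r k ^ n * cos (real n * t) / real n ^ 2) sums Re (Li_nat 2 (z k t))" for k t
  proof -
    have "(\<lambda>n. z k t ^ n / of_nat n ^ 2) sums Li_nat 2 (z k t)"
      using zn[of k t] by (intro Li_nat_sums) auto
    then have "(\<lambda>n. of_real (r k ^ n) * cis (real n * t) / of_real (real n ^ 2)) sums Li_nat 2 (z k t)"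
      by (simp add: powz)
    from sums_Re[OF this] show ?thesis
      by (simp only: times_complex.simps Re_divide_of_real Re_complex_of_real Im_complex_of_real cis.simps
            mult_zero_left diff_zero)
  qed
  have Ln1: "(\<lambda>n. - (r k ^ n * sin (real n * t) / real n)) sums Im (Ln (1 - z k t))" for k t
  proof -
    have "(\<lambda>n. - (z k t ^ n) / of_nat n) sums Ln (1 - z k t)"
      using Ln_series'[of "- z k t"] zn[of k t] by simp
    then have "(\<lambda>n. - (of_real (r k ^ n) * cis (real n * t)) / of_real (real n)) sums Ln (1 - z k t)"
      by (simp add: powz)
    from sums_Im[OF this] show ?thesis
      by (simp only: times_complex.simps uminus_complex.simps Im_divide_of_real Re_complex_of_real
            Im_complex_of_real cis.simps mult_zero_left add_0_right minus_divide_left)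
  qed
  have deriv: "((\<lambda>t. Re (Li_nat 2 (z k t))) has_field_derivative Im (Ln (1 - z k t))) (at t)" for k t
  proof -
    have geo: "summable (\<lambda>n. r k ^ n)" using r by (simp add: summable_geometric)
    have bound: "\<bar>r k ^ n * sin (real n * t) / real n\<bar> \<le> r k ^ n" for n t
    proof (cases "n = 0")
      case False
      then have "\<bar>sin (real n * t)\<bar> \<le> real n" using abs_sin_le_one[of "real n * t"] by linarith
      then have "r k ^ n * \<bar>sin (real n * t)\<bar> \<le> r k ^ n * real n"
        using r by (intro mult_left_mono) auto
      then show ?thesis using False r by (simp add: abs_mult divide_le_eq power_abs)
    qed simp
    have unif: "uniformly_convergent_on UNIV (\<lambda>n t. \<Sum>i<n. - (r k ^ i * sin (real i * t) / real i))"
      using bound by (intro Weierstrass_m_test'[OF _ geo]) simp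
    have "((\<lambda>t. \<Sum>n. r k ^ n * cos (real n * t) / real n ^ 2) has_field_derivative
        (\<Sum>n. - (r k ^ n * sin (real n * t) / real n))) (at t)"
    proof (rule has_field_derivative_series'(2)[OF convex_UNIV _ unif, where ?x0.0 = 0])
      show "((\<lambda>t. r k ^ n * cos (real n * t) / (real n)\<^sup>2) has_field_derivative
          - (r k ^ n * sin (real n * t) / real n)) (at t within UNIV)" for n t
        by (cases "n = 0") (auto intro!: derivative_eq_intros simp: power2_eq_square)
    qed (use Li2[of k 0] in \<open>simp_all add: sums_iff\<close>)
    then show ?thesis using Li2[of k] Ln1[of k t] by (simp add: sums_iff)
  qed
  \<comment> \<open>At \<open>t = 0\<close> the number \<open>1 - z k 0\<close> is a positive real,
    so the pointwise limit there is 0 and not \<open>- pi / 2\<close>; this single point is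
    discarded after the limit.\<close>
  have "((\<lambda>t. if t = 0 then 0 else (t - pi) / 2) has_integral
      (Re (Li_nat 2 (cis x)) - Re (Li_nat 2 (cis 0)))) {0..x}"
  proof (rule has_integral_dominated_convergence)
    show "((\<lambda>t. Im (Ln (1 - z k t))) has_integral Re (Li_nat 2 (z k x)) - Re (Li_nat 2 (z k 0))) {0..x}" for k
      using assms deriv[of k]
      by (intro fundamental_theorem_of_calculus)
         (auto simp: has_real_derivative_iff_has_vector_derivative[symmetric] intro: has_field_derivative_at_within)
    show "(\<lambda>_. pi) integrable_on {0..x}" by (rule integrable_const_ivl)
    show "\<forall>t\<in>{0..x}. norm (Im (Ln (1 - z k t))) \<le> pi" for k
      using mpi_less_Im_Ln[OF Ln_ne] Im_Ln_le_pi[OF Ln_ne] by (simp add: abs_le_iff less_imp_le minus_le_iff)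
    show "\<forall>t\<in>{0..x}. (\<lambda>k. Im (Ln (1 - z k t))) \<longlonglongrightarrow> (if t = 0 then 0 else (t - pi) / 2)"
    proof
      fix t assume t: "t \<in> {0..x}"
      show "(\<lambda>k. Im (Ln (1 - z k t))) \<longlonglongrightarrow> (if t = 0 then 0 else (t - pi) / 2)"
      proof (cases "t = 0")
        case True
        have "Im (Ln (1 - z k 0)) = 0" for k
        proof -
          have "1 - z k 0 = of_real (1 - r k)" by (simp add: z_def)
          then show ?thesis using r[of k] by (simp only: Im_Ln_of_real)
        qed
        then show ?thesis using True by simp
      next
        case False
        then have t': "0 < t" "t < 2 * pi" using t assms by auto
        have "1 - cis t \<notin> \<real>\<^sub>\<le>\<^sub>0"
        proof
          assume "1 - cis t \<in> \<real>\<^sub>\<le>\<^sub>0"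
          then have "cos t \<ge> 1" by (auto simp: complex_nonpos_Reals_iff)
          moreover have "sin (t / 2) > 0" using t' by (intro sin_gt_zero) auto
          ultimately show False using cos_double_sin[of "t / 2"] by simp
        qed
        then have "(\<lambda>k. Im (Ln (1 - z k t))) \<longlonglongrightarrow> Im (Ln (1 - cis t))"
          by (intro tendsto_intros zlim)
        then show ?thesis using False Ln_1_minus_cis[OF t'] by simp
      qed
    qed
    have cont: "(\<lambda>k. Li_nat 2 (z k t)) \<longlonglongrightarrow> Li_nat 2 (cis t)" for t
    proof (rule continuous_on_tendsto_compose[OF _ zlim])
      have "continuous_on (cball 0 1) (\<lambda>z. \<Sum>n. (1 / of_nat n ^ 2) * z ^ n :: complex)"
        using summable_inverse_nat_power[of 2]
        by (intro power_series_continuous_on_cball) (simp add: norm_divide norm_power)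
      then show "continuous_on (cball 0 1) (Li_nat 2)" by (simp add: Li_nat_def[abs_def])
    qed (use zn in \<open>auto intro!: always_eventually less_imp_le\<close>)
    show "(\<lambda>k. Re (Li_nat 2 (z k x)) - Re (Li_nat 2 (z k 0)))
        \<longlonglongrightarrow> Re (Li_nat 2 (cis x)) - Re (Li_nat 2 (cis 0))"
      by (intro tendsto_intros cont)
  qed
  then have "((\<lambda>t. (t - pi) / 2) has_integral
      (Re (Li_nat 2 (cis x)) - Re (Li_nat 2 (cis 0)))) {0..x}"
    by (rule has_integral_spike_finite[of "{0}", rotated 2]) auto
  moreover have "((\<lambda>t. (t - pi) / 2) has_integral ((x\<^sup>2 / 4 - pi * x / 2) - (0\<^sup>2 / 4 - pi * 0 / 2))) {0..x}"
    using assms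
    by (intro fundamental_theorem_of_calculus)
       (auto simp: has_real_derivative_iff_has_vector_derivative[symmetric] field_simps
             intro!: derivative_eq_intros)
  ultimately have "Re (Li_nat 2 (cis x)) - Re (Li_nat 2 (cis 0))
      = (x\<^sup>2 / 4 - pi * x / 2) - (0\<^sup>2 / 4 - pi * 0 / 2)"
    by (rule has_integral_unique)
  then have "Re (Li_nat 2 (cis x)) = Re (Li_nat 2 (cis 0)) + x\<^sup>2 / 4 - pi * x / 2"
    by simp
  moreover have "Re (Li_nat 2 (cis 0)) = pi\<^sup>2 / 6"
    by (simp only: Li_nat_cis_0 zeta_nat_2 order_refl)
  ultimately show ?thesis by linarith
qed

text \<open>Used to integrate the polynomial formulas from one order to the next, with the constant
  fixed at 0.\<close>

lemma DERIV_eq_on_interval: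
  fixes f g :: "real \<Rightarrow> real"
  assumes "\<And>t. 0 \<le> t \<Longrightarrow> t < c \<Longrightarrow> (f has_field_derivative h t) (at t)"
    and "\<And>t. 0 \<le> t \<Longrightarrow> t < c \<Longrightarrow> (g has_field_derivative h t) (at t)"
    and "f 0 = g 0" "0 \<le> x" "x < c"
  shows "f x = g x"
proof -
  have "\<exists>c'. \<forall>t\<in>{0..<c}. f t - g t = c'"
  proof (rule has_field_derivative_zero_constant)
    fix t assume "t \<in> {0..<c}"
    then show "((\<lambda>t. f t - g t) has_field_derivative 0) (at t within {0..<c})"
      using DERIV_diff[OF assms(1)[of t] assms(2)[of t]] by (auto intro: has_field_derivative_at_within)
  qed simp
  then obtain c' where c': "f t - g t = c'" if "0 \<le> t" "t < c" for t
    by auto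
  from c'[of 0] c'[of x] show ?thesis using assms(3-5) by simp
qed

lemma Im_Li_nat_3_cis:
  assumes "0 \<le> x" "x < 2 * pi"
  shows "Im (Li_nat 3 (cis x)) = pi\<^sup>2 * x / 6 - pi * x\<^sup>2 / 4 + x ^ 3 / 12"
proof (rule DERIV_eq_on_interval[OF _ _ _ assms, where h = "\<lambda>t. Re (Li_nat 2 (cis t))"])
  show "((\<lambda>x. Im (Li_nat 3 (cis x))) has_field_derivative Re (Li_nat 2 (cis t))) (at t)" for t
    using Li_nat_cis_has_derivative(1)[of 2 t] by simp
  show "((\<lambda>x. pi\<^sup>2 * x / 6 - pi * x\<^sup>2 / 4 + x ^ 3 / 12) has_field_derivative Re (Li_nat 2 (cis t))) (at t)"
    if "0 \<le> t" "t < 2 * pi" for t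
    using that by (auto intro!: derivative_eq_intros simp: Re_Li_nat_2_cis)
qed (use Li_nat_cis_0[of 3] in simp_all)

text \<open>The constant of integration is the value at \<open>x = 0\<close>, kept as
  \<open>zeta_nat 4\<close> until the next order determines it.\<close>

lemma Re_Li_nat_4_cis_aux:
  assumes "0 \<le> x" "x < 2 * pi"
  shows "Re (Li_nat 4 (cis x)) = zeta_nat 4 - pi\<^sup>2 * x\<^sup>2 / 12 + pi * x ^ 3 / 12 - x ^ 4 / 48"
proof (rule DERIV_eq_on_interval[OF _ _ _ assms, where h = "\<lambda>t. - Im (Li_nat 3 (cis t))"])
  show "((\<lambda>x. Re (Li_nat 4 (cis x))) has_field_derivative - Im (Li_nat 3 (cis t))) (at t)" for t
    using Li_nat_cis_has_derivative(2)[of 3 t] by simp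
  show "((\<lambda>x. zeta_nat 4 - pi\<^sup>2 * x\<^sup>2 / 12 + pi * x ^ 3 / 12 - x ^ 4 / 48) has_field_derivative
      - Im (Li_nat 3 (cis t))) (at t)" if "0 \<le> t" "t < 2 * pi" for t
    using that by (auto intro!: derivative_eq_intros simp: Im_Li_nat_3_cis)
qed (use Li_nat_cis_0[of 4] in simp_all)

lemma Im_Li_nat_5_cis_aux:
  assumes "0 \<le> x" "x < 2 * pi"
  shows "Im (Li_nat 5 (cis x)) = zeta_nat 4 * x - pi\<^sup>2 * x ^ 3 / 36 + pi * x ^ 4 / 48 - x ^ 5 / 240"
proof (rule DERIV_eq_on_interval[OF _ _ _ assms, where h = "\<lambda>t. Re (Li_nat 4 (cis t))"])
  show "((\<lambda>x. Im (Li_nat 5 (cis x))) has_field_derivative Re (Li_nat 4 (cis t))) (at t)" for t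
    using Li_nat_cis_has_derivative(1)[of 4 t] by simp
  show "((\<lambda>x. zeta_nat 4 * x - pi\<^sup>2 * x ^ 3 / 36 + pi * x ^ 4 / 48 - x ^ 5 / 240) has_field_derivative
      Re (Li_nat 4 (cis t))) (at t)" if "0 \<le> t" "t < 2 * pi" for t
    using that by (auto intro!: derivative_eq_intros simp: Re_Li_nat_4_cis_aux)
qed (use Li_nat_cis_0[of 5] in simp_all)

text \<open>All \<open>sin (real n * pi)\<close> vanish, so the order 5 polynomial has a zero at
  \<open>pi\<close>; this is a linear equation for \<open>zeta_nat 4\<close>.\<close>

lemma zeta_nat_4: "zeta_nat 4 = pi ^ 4 / 90"
proof -
  have "Im (Li_nat 5 (cis pi)) = 0"
    using Li_nat_cis_sums(2)[of 5 pi] by (simp add: sums_iff)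
  then have "pi * zeta_nat 4 = pi * (pi ^ 4 / 90)"
    using Im_Li_nat_5_cis_aux[of pi] by (simp add: eval_nat_numeral field_simps)
  then show ?thesis by simp
qed

lemma Re_Li_nat_4_cis:
  assumes "0 \<le> x" "x < 2 * pi"
  shows "Re (Li_nat 4 (cis x)) = pi ^ 4 / 90 - pi\<^sup>2 * x\<^sup>2 / 12 + pi * x ^ 3 / 12 - x ^ 4 / 48"
  using Re_Li_nat_4_cis_aux[OF assms] by (simp add: zeta_nat_4)

lemma Im_Li_nat_5_cis:
  assumes "0 \<le> x" "x < 2 * pi"
  shows "Im (Li_nat 5 (cis x)) = pi ^ 4 * x / 90 - pi\<^sup>2 * x ^ 3 / 36 + pi * x ^ 4 / 48 - x ^ 5 / 240"
  using Im_Li_nat_5_cis_aux[OF assms] by (simp add: zeta_nat_4)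

section \<open>The kernel integrals\<close>

text \<open>Imaginary part of the geometric series for \<open>cis x / (1 - t * cis x)\<close>. The
  angles \<open>pi / 3\<close> and \<open>2 * pi / 3\<close> give the denominators
  \<open>1 - t + t^2\<close> and \<open>1 + t + t^2\<close>.\<close>

lemma geometric_sin_sums:
  fixes t x :: real
  assumes "0 \<le> t" "t < 1"
  shows "(\<lambda>n. sin (real (Suc n) * x) * t ^ n) sums (sin x / (1 - 2 * t * cos x + t\<^sup>2))"
proof -
  have n: "norm (of_real t * cis x) < 1" using assms by (simp add: norm_mult)
  have "(\<lambda>n. cis x * (of_real t * cis x) ^ n) sums (cis x * (1 / (1 - of_real t * cis x)))"
    using geometric_sums[OF n] by (rule sums_mult)
  moreover have "cis x * (of_real t * cis x) ^ n = of_real (t ^ n) * cis (real (Suc n) * x)" for n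
    by (simp only: Complex.DeMoivre[symmetric] power_Suc power_mult_distrib of_real_power)
      (simp only: mult_ac)
  ultimately have "(\<lambda>n. of_real (t ^ n) * cis (real (Suc n) * x)) sums (cis x / (1 - of_real t * cis x))"
    by (simp only: times_divide_eq_right mult_1_right)
  from sums_Im[OF this]
  have "(\<lambda>n. t ^ n * sin (real (Suc n) * x)) sums Im (cis x / (1 - of_real t * cis x))"
    by (simp only: times_complex.simps Re_complex_of_real Im_complex_of_real cis.simps mult_zero_left add_0_right)
  moreover have "Im (cis x / (1 - of_real t * cis x)) = sin x / (1 - 2 * t * cos x + t\<^sup>2)"
  proof -
    have "(1 - t * cos x)\<^sup>2 + (t * sin x)\<^sup>2 = 1 - 2 * t * cos x + t\<^sup>2 * ((sin x)\<^sup>2 + (cos x)\<^sup>2)"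
      by algebra
    then have "(1 - t * cos x)\<^sup>2 + (t * sin x)\<^sup>2 = 1 - 2 * t * cos x + t\<^sup>2" by simp
    then show ?thesis
      by (simp add: Im_divide algebra_simps)
  qed
  ultimately show ?thesis by (simp add: mult.commute)
qed

text \<open>Termwise integration with a separate dominating function for each term: summability of
  the integrals of \<open>\<bar>f n t\<bar>\<close> is inherited from \<open>J\<close>.\<close>

lemma has_bochner_integral_suminf:
  fixes f :: "nat \<Rightarrow> 'a \<Rightarrow> real"
  assumes f: "\<And>n. has_bochner_integral M (f n) (I n)"
    and pt: "\<And>t. t \<in> space M \<Longrightarrow> (\<lambda>n. f n t) sums g t"
    and dom: "\<And>n. has_bochner_integral M (h n) (J n)"
    and le: "\<And>n t. t \<in> space M \<Longrightarrow> \<bar>f n t\<bar> \<le> h n t"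
    and pt_h: "\<And>t. t \<in> space M \<Longrightarrow> summable (\<lambda>n. h n t)"
    and "summable J"
  shows "has_bochner_integral M g (\<Sum>n. I n)" "summable I"
proof -
  have int: "integrable M (f n)" "integrable M (h n)" for n
    using f dom by (auto simp: has_bochner_integral_iff)
  have ae: "AE t in M. summable (\<lambda>n. norm (f n t))"
  proof (rule AE_I2)
    fix t assume "t \<in> space M"
    then show "summable (\<lambda>n. norm (f n t))"
      using le by (intro summable_comparison_test'[OF pt_h]) auto
  qed
  have sm: "summable (\<lambda>n. \<integral>t. norm (f n t) \<partial>M)"
  proof (rule summable_comparison_test'[OF \<open>summable J\<close>])
    fix n
    have "(\<integral>t. norm (f n t) \<partial>M) \<le> (\<integral>t. h n t \<partial>M)"
      using int le by (intro Bochner_Integration.integral_mono) auto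
    then show "norm (\<integral>t. norm (f n t) \<partial>M) \<le> J n"
      using dom by (simp add: has_bochner_integral_iff)
  qed
  have "has_bochner_integral M (\<lambda>t. \<Sum>n. f n t) (\<Sum>n. \<integral>t. f n t \<partial>M)"
    using integrable_suminf[OF int(1) ae sm] integral_suminf[OF int(1) ae sm]
    by (simp add: has_bochner_integral_iff)
  also have "(\<lambda>n. \<integral>t. f n t \<partial>M) = I"
    using f by (auto simp: has_bochner_integral_iff)
  finally show "has_bochner_integral M g (\<Sum>n. I n)"
    by (rule has_bochner_integral_cong[THEN iffD1, rotated -1]) (use pt in \<open>auto simp: sums_iff\<close>)
  show "summable I"
    using summable_integral[OF int(1) ae sm] \<open>(\<lambda>n. \<integral>t. f n t \<partial>M) = I\<close> by simp
qed

text \<open>Expands \<open>ln (1 - t)\<close> into powers of \<open>t\<close> and integrates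
  termwise; the factor 6 is \<open>fact 3\<close>. Both logarithms are negative, so the terms are
  nonnegative and dominate themselves.\<close>

lemma has_bochner_integral_ln3_ln:
  "has_bochner_integral unit_measure (\<lambda>t. t ^ n * (ln t ^ 3 * ln (1 - t))) (6 * shifted_sum (Suc n))"
proof -
  let ?f = "\<lambda>m t. - (t ^ (n + Suc m) * ln t ^ 3) / real (Suc m)"
  let ?I = "\<lambda>m. 6 * (1 / (real (Suc m) * real (Suc m + Suc n) ^ 4))"
  have sm: "summable (\<lambda>m. 1 / (real (Suc m) * real (Suc m + Suc n) ^ 4))"
    using sums_inverse_shifted_power4[of "Suc n"] by (simp add: sums_iff)
  have f: "has_bochner_integral unit_measure (?f m) (?I m)" for m
    using has_bochner_integral_divide_zero[OF has_bochner_integral_minus[OF has_bochner_integral_power_ln_power[of "n + Suc m" 3]],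
        of "real (Suc m)"]
    by (simp add: eval_nat_numeral field_simps)
  have pt: "(\<lambda>m. ?f m t) sums (t ^ n * (ln t ^ 3 * ln (1 - t)))" if "t \<in> space unit_measure" for t
  proof -
    have t: "0 < t" "t < 1" using that by auto
    have "(\<lambda>m. - (t ^ m) / real m) sums ln (1 - t)"
      using ln_series'[of "- t"] t by simp
    then have "(\<lambda>m. - (t ^ Suc m) / real (Suc m)) sums ln (1 - t)"
      by (subst sums_Suc_iff) simp
    from sums_mult[OF this, of "t ^ n * ln t ^ 3"] show ?thesis
      by (simp add: power_add mult_ac del: of_nat_Suc)
  qed
  have nonneg: "0 \<le> ?f m t" if "t \<in> space unit_measure" for m t
    using that by (intro divide_nonneg_nonneg) (auto simp: mult_nonneg_nonpos power3_eq_cube mult_nonpos_nonpos zero_le_mult_iff mult_le_0_iff)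
  have "has_bochner_integral unit_measure (\<lambda>t. t ^ n * (ln t ^ 3 * ln (1 - t))) (\<Sum>m. ?I m)"
  proof (rule has_bochner_integral_suminf(1)[OF f pt f])
    show "\<bar>?f m t\<bar> \<le> ?f m t" if "t \<in> space unit_measure" for m t
      using nonneg[OF that, of m] by (simp only: abs_of_nonneg order_refl)
    show "summable (\<lambda>m. ?f m t)" if "t \<in> space unit_measure" for t
      using pt[OF that] by (rule sums_summable)
    show "summable ?I" using sm by (rule summable_mult)
  qed
  then show ?thesis
    using sm by (simp only: shifted_sum_def suminf_mult)
qed

text \<open>Replaces the kernel by its sine series; since sines are at most 1 in absolute value, the
  moments \<open>t ^ n * a t\<close> serve as dominating functions.\<close>

lemma has_bochner_integral_sin_kernel:
  fixes a :: "real \<Rightarrow> real"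
  assumes I: "\<And>n. has_bochner_integral unit_measure (\<lambda>t. t ^ n * a t) (I n)"
    and "summable I" and nonneg: "\<And>t. t \<in> {0<..<1} \<Longrightarrow> 0 \<le> a t" and "sin x \<noteq> 0"
  shows "has_bochner_integral unit_measure (\<lambda>t. a t / (1 - 2 * t * cos x + t\<^sup>2))
    ((\<Sum>n. sin (real (Suc n) * x) * I n) / sin x)"
proof -
  let ?f = "\<lambda>n t. sin (real (Suc n) * x) * (t ^ n * a t)"
  have f: "has_bochner_integral unit_measure (?f n) (sin (real (Suc n) * x) * I n)" for n
    by (intro has_bochner_integral_mult_right I)
  have pt: "(\<lambda>n. ?f n t) sums (sin x * (a t / (1 - 2 * t * cos x + t\<^sup>2)))"
    if "t \<in> space unit_measure" for t
  proof -
    have "0 \<le> t" "t < 1" using that by auto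
    from sums_mult2[OF geometric_sin_sums[OF this, of x], of "a t"] show ?thesis
      by (simp add: mult_ac)
  qed
  have "has_bochner_integral unit_measure (\<lambda>t. sin x * (a t / (1 - 2 * t * cos x + t\<^sup>2)))
      (\<Sum>n. sin (real (Suc n) * x) * I n)"
  proof (rule has_bochner_integral_suminf(1)[OF f pt I _ _ \<open>summable I\<close>])
    show "\<bar>?f n t\<bar> \<le> t ^ n * a t" if "t \<in> space unit_measure" for n t
      using that nonneg[of t] abs_sin_le_one[of "real (Suc n) * x"]
        mult_right_mono[of "\<bar>sin (real (Suc n) * x)\<bar>" 1 "t ^ n * a t"]
      by (simp add: abs_mult del: of_nat_Suc)
    show "summable (\<lambda>n. t ^ n * a t)" if "t \<in> space unit_measure" for t
      using that by (intro summable_mult2 summable_geometric) auto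
  qed
  from has_bochner_integral_divide_zero[OF this, of "sin x"] show ?thesis
    using \<open>sin x \<noteq> 0\<close> by simp
qed

section \<open>Reflection and substitution on the unit interval\<close>

lemma has_bochner_integral_unit_reflect:
  fixes f :: "real \<Rightarrow> real"
  assumes "has_bochner_integral unit_measure f J"
  shows "has_bochner_integral unit_measure (\<lambda>t. f (1 - t)) J"
proof -
  have "(\<lambda>t. 1 - t) ` {0<..<1::real} = {0<..<1}"
  proof safe
    fix x :: real assume "x \<in> {0<..<1}"
    then show "x \<in> (\<lambda>t. 1 - t) ` {0<..<1}" by (intro image_eqI[of _ _ "1 - x"]) auto
  qed auto
  moreover have "(\<lambda>t. \<bar>- 1\<bar> * f (1 - t)) absolutely_integrable_on {0<..<1} \<and>
        integral {0<..<1} (\<lambda>t. \<bar>- 1\<bar> * f (1 - t)) = J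
      \<longleftrightarrow> f absolutely_integrable_on (\<lambda>t. 1 - t) ` {0<..<1} \<and> integral ((\<lambda>t. 1 - t) ` {0<..<1}) f = J"
    by (rule has_absolute_integral_change_of_variables_1')
       (auto intro!: derivative_eq_intros simp: inj_on_def)
  ultimately show ?thesis
    using assms by (simp add: has_bochner_integral_unit_iff)
qed

text \<open>The two choices of \<open>t\<close> are exchanged by \<open>t\<close> to
  \<open>1 - t\<close>, so the difference of logarithms is \<open>ln u\<close> or
  \<open>- ln u\<close>, with the same fourth power. In the denominator \<open>(1 + u) * t\<close>
  is \<open>u\<close> or 1, and both give the same quadratic.\<close>

lemma ln_pow4_substitution_aux:
  fixes t u :: real
  assumes "u > 0" "t = u / (1 + u) \<or> t = 1 / (1 + u)"
  shows "\<bar>1 / (1 + u)\<^sup>2\<bar> * ((ln t - ln (1 - t)) ^ 4 / (1 - t + t\<^sup>2)) = ln u ^ 4 / (1 + u + u\<^sup>2)"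
proof -
  have "(ln t - ln (1 - t)) ^ 4 = ln u ^ 4"
  proof -
    have eq: "1 - u / (1 + u) = 1 / (1 + u)" "1 - 1 / (1 + u) = u / (1 + u)"
      using assms(1) by (simp_all add: field_simps)
    have "0 < t" "t < 1"
      using assms by (auto simp: divide_less_eq)
    moreover have "t / (1 - t) = u \<or> t / (1 - t) = 1 / u"
    proof -
      have "u / (1 + u) / (1 - u / (1 + u)) = u" "1 / (1 + u) / (1 - 1 / (1 + u)) = 1 / u"
        unfolding eq using assms(1) by auto
      then show ?thesis using assms(2) by metis
    qed
    ultimately have "ln t - ln (1 - t) = ln u \<or> ln t - ln (1 - t) = - ln u"
      using assms(1) ln_div[of t "1 - t"] ln_div[of 1 u] by auto
    then show ?thesis by auto
  qed
  moreover have "(1 + u)\<^sup>2 * (1 - t + t\<^sup>2) = 1 + u + u\<^sup>2"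
  proof -
    define v where "v = (1 + u) * t"
    have "v = u \<or> v = 1" using assms by (auto simp: v_def)
    moreover have "(1 + u)\<^sup>2 * (1 - t + t\<^sup>2) = (1 + u)\<^sup>2 - (1 + u) * v + v\<^sup>2"
      by (simp add: v_def algebra_simps power2_eq_square)
    ultimately show ?thesis by (elim disjE) (simp_all add: algebra_simps power2_eq_square)
  qed
  ultimately show ?thesis by (simp add: mult.commute)
qed

text \<open>The quotient \<open>t / (1 - t)\<close> runs over the whole half-line. Splitting at
  \<open>t = 1 / 2\<close> and using its reciprocal on the upper half turns both halves into the
  same integral over \<open>0 < u < 1\<close>.\<close>

lemma has_integral_ln_difference_pow4:
  assumes "has_bochner_integral unit_measure (\<lambda>u. ln u ^ 4 / (1 + u + u\<^sup>2)) K"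
  shows "((\<lambda>t. (ln t - ln (1 - t)) ^ 4 / (1 - t + t\<^sup>2)) has_integral 2 * K) {0<..<1}"
proof -
  let ?g = "\<lambda>t::real. (ln t - ln (1 - t)) ^ 4 / (1 - t + t\<^sup>2)"
  have half: "(?g has_integral K) (\<phi> ` {0<..<1})"
    if der: "\<And>u. u \<in> {0<..<1} \<Longrightarrow> (\<phi> has_field_derivative \<phi>' u) (at u within {0<..<1})"
      and inj: "inj_on \<phi> {0<..<1}"
      and eq: "\<And>u. u \<in> {0<..<1} \<Longrightarrow> \<bar>\<phi>' u\<bar> * ?g (\<phi> u) = ln u ^ 4 / (1 + u + u\<^sup>2)"
    for \<phi> \<phi>' :: "real \<Rightarrow> real"
  proof -
    have "has_bochner_integral unit_measure (\<lambda>u. \<bar>\<phi>' u\<bar> * ?g (\<phi> u)) K"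
      using assms by (rule has_bochner_integral_cong[THEN iffD1, rotated -1]) (use eq in auto)
    then have "(\<lambda>u. \<bar>\<phi>' u\<bar> * ?g (\<phi> u)) absolutely_integrable_on {0<..<1} \<and>
        integral {0<..<1} (\<lambda>u. \<bar>\<phi>' u\<bar> * ?g (\<phi> u)) = K"
      by (simp only: has_bochner_integral_unit_iff)
    then have "?g absolutely_integrable_on (\<phi> ` {0<..<1}) \<and> integral (\<phi> ` {0<..<1}) ?g = K"
      by (subst (asm) has_absolute_integral_change_of_variables_1'[OF _ der inj]) auto
    then show ?thesis
      using set_lebesgue_integral_eq_integral(1) by (auto simp: has_integral_iff)
  qed
  have "(?g has_integral K) ((\<lambda>u. u / (1 + u)) ` {0<..<1})"
  proof (rule half)
    show "((\<lambda>u. u / (1 + u)) has_field_derivative 1 / (1 + u)\<^sup>2) (at u within {0<..<1})"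
      if "u \<in> {0<..<1}" for u :: real
      using that by (auto intro!: derivative_eq_intros simp: power2_eq_square)
    show "inj_on (\<lambda>u. u / (1 + u)) {0<..<1::real}" by (auto simp: inj_on_def field_simps)
    show "\<bar>1 / (1 + u)\<^sup>2\<bar> * ?g (u / (1 + u)) = ln u ^ 4 / (1 + u + u\<^sup>2)"
      if "u \<in> {0<..<1}" for u :: real
      using that by (intro ln_pow4_substitution_aux) auto
  qed
  also have "(\<lambda>u. u / (1 + u)) ` {0<..<1} = {0<..<1 / 2 :: real}"
  proof safe
    fix x :: real assume "x \<in> {0<..<1 / 2}"
    then show "x \<in> (\<lambda>u. u / (1 + u)) ` {0<..<1}"
      by (intro image_eqI[of _ _ "x / (1 - x)"]) (auto simp: field_simps)
  qed (auto simp: field_simps)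
  finally have left: "(?g has_integral K) {0<..<1 / 2}" .
  have "(?g has_integral K) ((\<lambda>u. 1 / (1 + u)) ` {0<..<1})"
  proof (rule half)
    show "((\<lambda>u. 1 / (1 + u)) has_field_derivative - (1 / (1 + u)\<^sup>2)) (at u within {0<..<1})"
      if "u \<in> {0<..<1}" for u :: real
      using that by (auto intro!: derivative_eq_intros simp: power2_eq_square)
    show "inj_on (\<lambda>u. 1 / (1 + u)) {0<..<1::real}" by (auto simp: inj_on_def field_simps)
    show "\<bar>- (1 / (1 + u)\<^sup>2)\<bar> * ?g (1 / (1 + u)) = ln u ^ 4 / (1 + u + u\<^sup>2)"
      if "u \<in> {0<..<1}" for u :: real
      unfolding abs_minus using that by (intro ln_pow4_substitution_aux) auto
  qed
  also have "(\<lambda>u. 1 / (1 + u)) ` {0<..<1} = {1 / 2<..<1 :: real}"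
  proof safe
    fix x :: real assume "x \<in> {1 / 2<..<1}"
    then show "x \<in> (\<lambda>u. 1 / (1 + u)) ` {0<..<1}"
      by (intro image_eqI[of _ _ "(1 - x) / x"]) (auto simp: field_simps)
  qed (auto simp: field_simps)
  finally have right: "(?g has_integral K) {1 / 2<..<1}" .
  have "(?g has_integral K + K) ({0<..<1 / 2} \<union> {1 / 2<..<1})"
  proof (rule has_integral_Un[OF left right])
    have "{0<..<1 / 2} \<inter> {1 / 2<..<1} = ({} :: real set)" by auto
    then show "negligible ({0<..<1 / 2} \<inter> {1 / 2<..<1} :: real set)" by simp
  qed
  \<comment> \<open>The two halves miss only the null set consisting of
    \<open>1 / 2\<close>.\<close>
  then have "(?g has_integral K + K) {0<..<1}"
    by (rule has_integral_spike_set_eq[THEN iffD1, rotated 2])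
       (rule negligible_subset[OF negligible_sing[of "1 / 2"]]; force)+
  then show ?thesis by simp
qed

section \<open>Evaluation of the kernel integrals and of the derivative sum\<close>

lemma summable_shifted_sum_Suc: "summable (\<lambda>n. shifted_sum (Suc n))"
  using summable_shifted_sum by (subst (asm) summable_Suc_iff[symmetric]) (simp add: summable_rabs_cancel)

text \<open>The sine kernel at the angle \<open>pi / 3\<close>; the constant is
  \<open>6 / sin (pi / 3) = 4 * sqrt 3\<close>.\<close>

lemma has_bochner_integral_ln3_ln_kernel:
  "has_bochner_integral unit_measure (\<lambda>t. ln t ^ 3 * ln (1 - t) / (1 - t + t\<^sup>2))
     (4 * sqrt 3 * (\<Sum>n. sin (real (Suc n) * (pi / 3)) * shifted_sum (Suc n)))"
proof -
  have sm: "summable (\<lambda>n. 6 * shifted_sum (Suc n))"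
    using summable_shifted_sum_Suc by (rule summable_mult)
  have sm': "summable (\<lambda>n. sin (real (Suc n) * (pi / 3)) * shifted_sum (Suc n))"
  proof (rule summable_comparison_test'[OF summable_shifted_sum_Suc])
    show "norm (sin (real (Suc n) * (pi / 3)) * shifted_sum (Suc n)) \<le> shifted_sum (Suc n)" for n
      using shifted_sum_bounds(1)[of "Suc n"] abs_sin_le_one[of "real (Suc n) * (pi / 3)"]
        mult_right_mono[of "\<bar>sin (real (Suc n) * (pi / 3))\<bar>" 1 "shifted_sum (Suc n)"]
      by (simp add: abs_mult del: of_nat_Suc)
  qed
  have "has_bochner_integral unit_measure (\<lambda>t. (ln t ^ 3 * ln (1 - t)) / (1 - 2 * t * cos (pi / 3) + t\<^sup>2))
      ((\<Sum>n. sin (real (Suc n) * (pi / 3)) * (6 * shifted_sum (Suc n))) / sin (pi / 3))"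
    by (rule has_bochner_integral_sin_kernel[OF has_bochner_integral_ln3_ln sm])
       (auto simp: sin_60 power3_eq_cube zero_le_mult_iff mult_le_0_iff)
  also have "(\<Sum>n. sin (real (Suc n) * (pi / 3)) * (6 * shifted_sum (Suc n))) / sin (pi / 3)
      = 4 * sqrt 3 * (\<Sum>n. sin (real (Suc n) * (pi / 3)) * shifted_sum (Suc n))"
    using suminf_mult[OF sm', of 6]
    by (simp add: sin_60 field_simps del: of_nat_Suc)
  finally show ?thesis by (simp add: cos_60)
qed

text \<open>The sine kernel at the angle \<open>2 * pi / 3\<close>; the constant is
  \<open>fact 4 / sin (2 * pi / 3) = 16 * sqrt 3\<close>.\<close>

lemma has_bochner_integral_ln4_kernel:
  "has_bochner_integral unit_measure (\<lambda>t. ln t ^ 4 / (1 + t + t\<^sup>2))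
     (16 * sqrt 3 * Im (Li_nat 5 (cis (2 * pi / 3))))"
proof -
  let ?x = "2 * pi / 3"
  have sin: "sin ?x = sqrt 3 / 2" using sin_pi_minus[of "pi / 3"] by (simp add: sin_60)
  have cos: "cos ?x = - (1 / 2)" using cos_pi_minus[of "pi / 3"] by (simp add: cos_60)
  have S: "(\<lambda>n. sin (real (Suc n) * ?x) / real (Suc n) ^ 5) sums Im (Li_nat 5 (cis ?x))"
    using Li_nat_cis_sums(2)[of 5 ?x] by (subst sums_Suc_iff) simp
  have M: "has_bochner_integral unit_measure (\<lambda>t. t ^ n * ln t ^ 4) (24 / real (Suc n) ^ 5)" for n
  proof -
    have "(-1) ^ 4 * fact 4 / real (Suc n) ^ Suc 4 = 24 / real (Suc n) ^ 5"
      by (simp add: fact_numeral)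
    then show ?thesis using has_bochner_integral_power_ln_power[of n 4] by (simp only:)
  qed
  have "summable (\<lambda>n. 1 / real (Suc n) ^ 5)"
    using summable_inverse_nat_power[of 5] by (subst summable_Suc_iff) simp
  from summable_mult[OF this, of 24] have sm: "summable (\<lambda>n. 24 / real (Suc n) ^ 5)" by simp
  have "has_bochner_integral unit_measure (\<lambda>t. ln t ^ 4 / (1 - 2 * t * cos ?x + t\<^sup>2))
      ((\<Sum>n. sin (real (Suc n) * ?x) * (24 / real (Suc n) ^ 5)) / sin ?x)"
    by (rule has_bochner_integral_sin_kernel[OF M sm]) (auto simp: sin)
  also have "(\<Sum>n. sin (real (Suc n) * ?x) * (24 / real (Suc n) ^ 5)) = 24 * Im (Li_nat 5 (cis ?x))"
    using sums_mult[OF S, of 24] by (simp add: sums_iff mult_ac del: of_nat_Suc)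
  also have "24 * Im (Li_nat 5 (cis ?x)) / sin ?x = 16 * sqrt 3 * Im (Li_nat 5 (cis ?x))"
    unfolding sin by (simp add: field_simps)
  finally show ?thesis unfolding cos by simp
qed

text \<open>Geometric series in \<open>t * (1 - t)\<close> under the integral, using
  \<open>1 - t * (1 - t) = 1 - t + t^2\<close>.\<close>

lemma fourth_deriv_gamma_ratio_sums:
  obtains s where "(\<lambda>k. (deriv ^^ 4) gamma_ratio (real (Suc k))) sums s"
    and "has_bochner_integral unit_measure (\<lambda>t. (ln t + ln (1 - t)) ^ 4 / (1 - t + t\<^sup>2)) (2 * s)"
proof -
  let ?d = "\<lambda>k. (deriv ^^ 4) gamma_ratio (real (Suc k))"
  have d: "has_bochner_integral unit_measure (\<lambda>t. (t * (1 - t)) ^ k * ln (t * (1 - t)) ^ 4) (2 * ?d k)" for k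
  proof -
    have "has_bochner_integral unit_measure
        (\<lambda>t. 1 / (t * (1 - t)) * ln (t * (1 - t)) ^ 4 * exp (real (Suc k) * ln (t * (1 - t)))) (2 * ?d k)"
      using deriv_gamma_ratio[of "real (Suc k)" 4] by (simp add: has_bochner_integral_iff)
    then show ?thesis
    proof (rule has_bochner_integral_cong[THEN iffD1, rotated -1])
      fix t assume "t \<in> space unit_measure"
      then have "0 < t * (1 - t)" by auto
      then have "exp (real (Suc k) * ln (t * (1 - t))) = (t * (1 - t)) ^ Suc k"
        by (simp only: exp_of_nat_mult exp_ln)
      then show "1 / (t * (1 - t)) * ln (t * (1 - t)) ^ 4 * exp (real (Suc k) * ln (t * (1 - t)))
          = (t * (1 - t)) ^ k * ln (t * (1 - t)) ^ 4"
        using \<open>0 < t * (1 - t)\<close> by simp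
    qed auto
  qed
  \<comment> \<open>Since \<open>t * (1 - t) \<le> 1 / 4\<close>, the integrand for \<open>k\<close>
    is at most \<open>(1 / 4) ^ k\<close> times the one for 0.\<close>
  have dom: "has_bochner_integral unit_measure (\<lambda>t. (1 / 4) ^ k * ln (t * (1 - t)) ^ 4) ((1 / 4) ^ k * (2 * ?d 0))" for k
    using has_bochner_integral_mult_right[OF d[of 0], of "(1 / 4) ^ k"] by simp
  have quarter: "t * (1 - t) \<le> 1 / 4" for t :: real
    using sum_squares_ge_zero[of "t - 1 / 2" 0] by (simp add: algebra_simps)
  have pt: "(\<lambda>k. (t * (1 - t)) ^ k * ln (t * (1 - t)) ^ 4) sums
      ((ln t + ln (1 - t)) ^ 4 / (1 - t + t\<^sup>2))" if "t \<in> space unit_measure" for t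
  proof -
    have t: "0 < t" "t < 1" using that by auto
    then have "norm (t * (1 - t)) < 1" using quarter[of t] by (simp add: abs_mult)
    from sums_mult2[OF geometric_sums[OF this], of "ln (t * (1 - t)) ^ 4"]
    have "(\<lambda>k. (t * (1 - t)) ^ k * ln (t * (1 - t)) ^ 4) sums
      (1 / (1 - t * (1 - t)) * ln (t * (1 - t)) ^ 4)" .
    moreover have "ln (t * (1 - t)) = ln t + ln (1 - t)" using t by (simp add: ln_mult)
    moreover have "1 - t * (1 - t) = 1 - t + t\<^sup>2" by (simp add: power2_eq_square algebra_simps)
    ultimately show ?thesis by simp
  qed
  have bound: "\<bar>(t * (1 - t)) ^ k * ln (t * (1 - t)) ^ 4\<bar> \<le> (1 / 4) ^ k * ln (t * (1 - t)) ^ 4"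
    if "t \<in> space unit_measure" for t k
  proof -
    have "0 \<le> t * (1 - t)" using that by auto
    then have "(t * (1 - t)) ^ k \<le> (1 / 4) ^ k" using quarter by (intro power_mono)
    then have "(t * (1 - t)) ^ k * ln (t * (1 - t)) ^ 4 \<le> (1 / 4) ^ k * ln (t * (1 - t)) ^ 4"
      by (intro mult_right_mono) auto
    moreover have "0 \<le> (t * (1 - t)) ^ k * ln (t * (1 - t)) ^ 4"
      using \<open>0 \<le> t * (1 - t)\<close> by (intro mult_nonneg_nonneg) auto
    ultimately show ?thesis by linarith
  qed
  have geo: "summable (\<lambda>k. (1 / 4) ^ k * c)" for c :: real
    by (intro summable_mult2 summable_geometric) simp
  note * = has_bochner_integral_suminf[OF d pt dom bound geo geo]
  have "summable ?d" using *(2) by (simp del: of_nat_Suc)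
  then have "?d sums suminf ?d" "(\<Sum>k. 2 * ?d k) = 2 * suminf ?d"
    by (simp_all add: summable_sums suminf_mult del: of_nat_Suc)
  with *(1) show ?thesis by (intro that[of "suminf ?d"]) simp_all
qed

text \<open>The integral of \<open>(ln t - ln (1 - t)) ^ 4\<close> against the kernel is evaluated
  twice: by linearity it is \<open>2 * s - 64 * sqrt 3 * X\<close>, by substitution
  \<open>2 * K\<close>. Solving for \<open>s\<close> gives the value.\<close>

lemma fourth_deriv_gamma_ratio_sums_eq:
  "(\<lambda>k. (deriv ^^ 4) gamma_ratio (real (Suc k))) sums
    (32 * sqrt 3 * (\<Sum>n. sin (real (Suc n) * (pi / 3)) * shifted_sum (Suc n))
      + 16 * sqrt 3 * Im (Li_nat 5 (cis (2 * pi / 3))))"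
proof -
  obtain s where s: "(\<lambda>k. (deriv ^^ 4) gamma_ratio (real (Suc k))) sums s"
    and S: "has_bochner_integral unit_measure (\<lambda>t. (ln t + ln (1 - t)) ^ 4 / (1 - t + t\<^sup>2)) (2 * s)"
    by (rule fourth_deriv_gamma_ratio_sums)
  define X where "X = (\<Sum>n. sin (real (Suc n) * (pi / 3)) * shifted_sum (Suc n))"
  define K where "K = 16 * sqrt 3 * Im (Li_nat 5 (cis (2 * pi / 3)))"
  note J = has_bochner_integral_ln3_ln_kernel[folded X_def]
  have J': "has_bochner_integral unit_measure (\<lambda>t. ln (1 - t) ^ 3 * ln t / (1 - t + t\<^sup>2)) (4 * sqrt 3 * X)"
    using has_bochner_integral_unit_reflect[OF J]
    by (simp add: power2_eq_square algebra_simps)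
  have "has_bochner_integral unit_measure
      (\<lambda>t. (ln t + ln (1 - t)) ^ 4 / (1 - t + t\<^sup>2) - 8 * (ln t ^ 3 * ln (1 - t) / (1 - t + t\<^sup>2)
        + ln (1 - t) ^ 3 * ln t / (1 - t + t\<^sup>2)))
      (2 * s - 8 * (4 * sqrt 3 * X + 4 * sqrt 3 * X))"
    by (intro has_bochner_integral_diff has_bochner_integral_mult_right has_bochner_integral_add S J J')
  also have "(\<lambda>t::real. (ln t + ln (1 - t)) ^ 4 / (1 - t + t\<^sup>2) - 8 * (ln t ^ 3 * ln (1 - t) / (1 - t + t\<^sup>2)
        + ln (1 - t) ^ 3 * ln t / (1 - t + t\<^sup>2)))
      = (\<lambda>t. (ln t - ln (1 - t)) ^ 4 / (1 - t + t\<^sup>2))"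
  proof
    fix t :: real
    have "(a + b) ^ 4 - 8 * (a ^ 3 * b + b ^ 3 * a) = (a - b) ^ 4" for a b :: real
      by algebra
    from this[of "ln t" "ln (1 - t)", symmetric]
    show "(ln t + ln (1 - t)) ^ 4 / (1 - t + t\<^sup>2) - 8 * (ln t ^ 3 * ln (1 - t) / (1 - t + t\<^sup>2)
        + ln (1 - t) ^ 3 * ln t / (1 - t + t\<^sup>2)) = (ln t - ln (1 - t)) ^ 4 / (1 - t + t\<^sup>2)"
      by (simp add: diff_divide_distrib add_divide_distrib)
  qed
  finally have "integral {0<..<1} (\<lambda>t. (ln t - ln (1 - t)) ^ 4 / (1 - t + t\<^sup>2))
      = 2 * s - 8 * (4 * sqrt 3 * X + 4 * sqrt 3 * X)"
    by (simp add: has_bochner_integral_unit_iff)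
  moreover have "integral {0<..<1} (\<lambda>t. (ln t - ln (1 - t)) ^ 4 / (1 - t + t\<^sup>2)) = 2 * K"
    using has_integral_ln_difference_pow4[OF has_bochner_integral_ln4_kernel] 
    by (simp add: integral_unique K_def)
  ultimately have "s = 32 * sqrt 3 * X + K" by (simp add: algebra_simps)
  with s show ?thesis by (simp add: X_def K_def)
qed

section \<open>Values at the sixth root of unity\<close>

text \<open>Spreads a series over the even indices, so that terms at \<open>n\<close> and
  \<open>n div 2\<close> can be added index by index.\<close>

lemma sums_even_reindex:
  fixes f :: "nat \<Rightarrow> real"
  assumes "f sums s"
  shows "(\<lambda>n. if even n then f (n div 2) else 0) sums s"
proof -
  have "strict_mono (\<lambda>n::nat. 2 * n)" by (auto simp: strict_mono_def)
  then have "(\<lambda>n. (\<lambda>n. if even n then f (n div 2) else 0) (2 * n)) sums s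
      \<longleftrightarrow> (\<lambda>n. if even n then f (n div 2) else 0) sums s"
    by (rule sums_mono_reindex) (auto simp: image_iff elim!: evenE)
  then show ?thesis using assms by simp
qed

text \<open>Both sides have period 6, so six residues are checked; the sine is a combination of the
  character and its dilation by 2.\<close>

lemma sin_pi_third_multiple:
  "sin (real n * (pi / 3)) =
     sqrt 3 / 2 * (chi_m3 n + 2 * (if even n then chi_m3 (n div 2) else 0))"
proof -
  define q r where "q = n div 6" and "r = n mod 6"
  have n: "n = 6 * q + r" by (simp add: q_def r_def)
  have "real n * (pi / 3) = real r * (pi / 3) + 2 * of_nat q * pi"
    by (simp add: n field_simps)
  then have "sin (real n * (pi / 3)) = sin (real r * (pi / 3))"
    by (simp only: sin_add sin_2npi cos_2npi mult_zero_right mult_1_right add_0_right)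
  moreover have "sin (2 * pi / 3) = sqrt 3 / 2" 
    using sin_pi_minus[of "pi / 3"] by (simp add: sin_60)
  moreover have "sin (4 * pi / 3) = - (sqrt 3 / 2)"
    using sin_periodic_pi[of "pi / 3"] by (simp add: sin_60)
  moreover have "sin (5 * pi / 3) = - (sqrt 3 / 2)"
    using sin_2pi_minus[of "pi / 3"] by (simp add: sin_60)
  moreover have "r = 0 \<or> r = 1 \<or> r = 2 \<or> r = 3 \<or> r = 4 \<or> r = 5"
    unfolding r_def by linarith
  ultimately have "sin (real n * (pi / 3)) =
     sqrt 3 / 2 * (chi_m3 r + 2 * (if even r then chi_m3 (r div 2) else 0))"
    by (elim disjE) (simp_all add: sin_60 chi_m3_def)
  moreover have "chi_m3 n = chi_m3 r"
  proof -
    have "n mod 3 = r mod 3" unfolding r_def by (simp add: mod_mod_cancel)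
    then show ?thesis by (simp add: chi_m3_def)
  qed
  moreover have "chi_m3 (n div 2) = chi_m3 (r div 2)"
  proof -
    have "n div 2 = 3 * q + r div 2" unfolding n by simp
    then show ?thesis by (simp add: chi_m3_def)
  qed
  moreover have "even n \<longleftrightarrow> even r" unfolding n by simp
  ultimately show ?thesis by (simp only:)
qed

text \<open>Turns the complex powers into real integer powers and shifts the series to start at 0,
  where the character vanishes.\<close>

lemma L_m3_2_sums:
  obtains L where "L_m3 2 = of_real L" "(\<lambda>n. chi_m3 n / real n ^ 2) sums L"
proof -
  have "summable (\<lambda>n. chi_m3 n / real n ^ 2)"
    by (rule summable_comparison_test'[OF summable_inverse_nat_power[of 2]])
       (auto simp: chi_m3_def)
  then obtain L where L: "(\<lambda>n. chi_m3 n / real n ^ 2) sums L" by (auto simp: summable_def)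
  then have "(\<lambda>n. chi_m3 (Suc n) / real (Suc n) ^ 2) sums L"
    by (subst sums_Suc_iff) (simp add: chi_m3_def)
  then have "(\<lambda>n. complex_of_real (chi_m3 (Suc n) / real (Suc n) ^ 2)) sums of_real L"
    by (rule sums_of_real)
  moreover have "complex_of_real (chi_m3 (Suc n) / real (Suc n) ^ 2)
      = of_int (chi_m3 (Suc n)) * of_nat (Suc n) powr (- 2)" for n
  proof -
    have "complex_of_nat (Suc n) powr (of_nat 2) = of_nat (Suc n) ^ 2"
      by (rule powr_nat') simp
    then show ?thesis by (simp add: powr_minus divide_inverse del: of_nat_Suc)
  qed
  ultimately have "L_m3 2 = of_real L" by (simp add: L_m3_def sums_iff)
  with L show ?thesis by (rule that[rotated])
qed

lemma riemann_zeta_3: "riemann_zeta 3 = of_real (zeta_nat 3)"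
proof -
  have "(\<lambda>n. 1 / real (Suc n) ^ 3) sums zeta_nat 3"
    using sums_zeta_tail[of 3 0] by (simp add: harm_pow_def)
  then have "(\<lambda>n. complex_of_real (1 / real (Suc n) ^ 3)) sums of_real (zeta_nat 3)"
    by (rule sums_of_real)
  moreover have "complex_of_real (1 / real (Suc n) ^ 3) = 1 / of_nat (Suc n) powr 3" for n
  proof -
    have "complex_of_nat (Suc n) powr (of_nat 3) = of_nat (Suc n) ^ 3"
      by (rule powr_nat') simp
    then show ?thesis by (simp del: of_nat_Suc)
  qed
  ultimately show ?thesis by (simp add: riemann_zeta_def sums_iff)
qed

text \<open>On an even index \<open>n = 2 * m\<close> the factor 2 over \<open>n^2 = 4 * m^2\<close>
  leaves half of the series for \<open>L\<close>, so the constant is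
  \<open>sqrt 3 / 2 * (1 + 1 / 2)\<close>.\<close>

lemma Im_Li_nat_2_sixth_root:
  assumes "(\<lambda>n. chi_m3 n / real n ^ 2) sums L"
  shows "Im (Li_nat 2 (cis (pi / 3))) = 3 * sqrt 3 / 4 * L"
proof -
  have "(\<lambda>n. if even n then chi_m3 (n div 2) / real (n div 2) ^ 2 else 0) sums L"
    using assms by (rule sums_even_reindex)
  from sums_mult[OF sums_add[OF assms sums_divide[OF this, of 2]], of "sqrt 3 / 2"]
  have "(\<lambda>n. sqrt 3 / 2 * (chi_m3 n / real n ^ 2
      + (if even n then chi_m3 (n div 2) / real (n div 2) ^ 2 else 0) / 2)) sums (3 * sqrt 3 / 4 * L)"
    by (simp add: field_simps)
  moreover have "sqrt 3 / 2 * (chi_m3 n / real n ^ 2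
      + (if even n then chi_m3 (n div 2) / real (n div 2) ^ 2 else 0) / 2)
      = sin (real n * (pi / 3)) / real n ^ 2" for n
    unfolding sin_pi_third_multiple
    by (cases "n = 0") (auto elim!: evenE simp: field_simps power2_eq_square)
  ultimately have "(\<lambda>n. sin (real n * (pi / 3)) / real n ^ 2) sums (3 * sqrt 3 / 4 * L)"
    by (simp only:)
  with Li_nat_cis_sums(2)[of 2 "pi / 3"] show ?thesis
    by (simp add: sums_iff)
qed

text \<open>At this point \<open>1 - \<omega>\<close> has modulus 1, so its logarithm is purely
  imaginary and only the real part of Li_4 enters the imaginary part of the product.\<close>

lemma sin_shifted_sum_eq:
  "(\<Sum>n. sin (real (Suc n) * (pi / 3)) * shifted_sum (Suc n)) =
     17 * pi ^ 5 / 3888 - zeta_nat 3 * Im (Li_nat 2 (cis (pi / 3))) - Gl41 (pi / 3)"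
proof -
  let ?w = "cis (pi / 3)"
  have "norm ?w \<le> 1" "?w \<noteq> 1" by (auto simp: complex_eq_iff sin_60)
  note series = shifted_sum_power_series[OF this]
  define s where "s = - Ln (1 - ?w) * (Li_nat 4 ?w - of_real (zeta_nat 4)) - of_real (zeta_nat 3) * Li_nat 2 ?w
     - of_real (zeta_nat 2) * Li_nat 3 ?w - Li41 ?w + 4 * Li_nat 5 ?w"
  let ?f = "\<lambda>n. sin (real n * (pi / 3)) * (if n = 0 then 0 else shifted_sum n)"
  have "?f sums Im s"
    using sums_Im[OF series[folded s_def]]
    by (simp only: Complex.DeMoivre times_complex.simps Re_complex_of_real Im_complex_of_real cis.simps
          mult_zero_left add_0_right mult.commute)
  then have "(\<lambda>n. ?f (Suc n)) sums Im s"
    by (subst sums_Suc_iff) simp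
  then have S: "(\<lambda>n. sin (real (Suc n) * (pi / 3)) * shifted_sum (Suc n)) sums Im s"
    by (simp del: of_nat_Suc)
  have "Ln (1 - ?w) = Complex 0 (- (pi / 3))"
    using Ln_1_minus_cis[of "pi / 3"] by (simp add: sin_30)
  then have "Im s = pi / 3 * (Re (Li_nat 4 ?w) - zeta_nat 4) - zeta_nat 3 * Im (Li_nat 2 ?w)
      - zeta_nat 2 * Im (Li_nat 3 ?w) - Im (Li41 ?w) + 4 * Im (Li_nat 5 ?w)"
    by (simp add: s_def)
  also have "Im (Li41 ?w) = Gl41 (pi / 3)"
    by (simp add: Gl41_def cis_conv_exp)
  also have "pi / 3 * (Re (Li_nat 4 ?w) - zeta_nat 4) - zeta_nat 3 * Im (Li_nat 2 ?w)
      - zeta_nat 2 * Im (Li_nat 3 ?w) - Gl41 (pi / 3) + 4 * Im (Li_nat 5 ?w)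
      = 17 * pi ^ 5 / 3888 - zeta_nat 3 * Im (Li_nat 2 ?w) - Gl41 (pi / 3)"
  proof -
    \<comment> \<open>The polynomials at \<open>x = pi / 3\<close>. Over the denominator 58320 the
      multiples of \<open>pi ^ 5\<close> from Li_4, Li_3 and Li_5 are -125, -300 and 680, which add
      up to 17/3888.\<close>
    have v: "Re (Li_nat 4 ?w) = 91 * pi ^ 4 / 19440" "Im (Li_nat 3 ?w) = 5 * pi ^ 3 / 162"
      "Im (Li_nat 5 ?w) = 17 * pi ^ 5 / 5832"
      by (subst Re_Li_nat_4_cis Im_Li_nat_3_cis Im_Li_nat_5_cis;
          simp add: field_simps eval_nat_numeral)+
    show ?thesis
      unfolding v zeta_nat_2 zeta_nat_4 by (simp add: field_simps eval_nat_numeral)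
  qed
  finally show ?thesis using S by (simp add: sums_iff)
qed

theorem corollary1p4:
  shows "(\<lambda>k. complex_of_real ((deriv ^^ 4) gamma_ratio (real (Suc k)))) sums
    (- 72 * riemann_zeta 3 * L_m3 2
     + complex_of_real (134 * pi ^ 5 / (243 * sqrt 3))
     - complex_of_real (32 * sqrt 3 * Gl41 (pi / 3)))"
proof -
  obtain L where L: "L_m3 2 = of_real L" "(\<lambda>n. chi_m3 n / real n ^ 2) sums L"
    by (rule L_m3_2_sums)
  have "Im (Li_nat 5 (cis (2 * pi / 3))) = 2 * pi ^ 5 / 729"
    by (subst Im_Li_nat_5_cis) (simp_all add: field_simps eval_nat_numeral)
  \<comment> \<open>The constants are \<open>32 * sqrt 3 * (3 * sqrt 3 / 4) = 72\<close> and
    \<open>32 * 17 / 3888 + 16 * 2 / 729 = 134 / 729\<close>.\<close>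
  then have "32 * sqrt 3 * (\<Sum>n. sin (real (Suc n) * (pi / 3)) * shifted_sum (Suc n))
      + 16 * sqrt 3 * Im (Li_nat 5 (cis (2 * pi / 3)))
    = - 72 * zeta_nat 3 * L + 134 * pi ^ 5 / 729 * sqrt 3 - 32 * sqrt 3 * Gl41 (pi / 3)"
    unfolding sin_shifted_sum_eq Im_Li_nat_2_sixth_root[OF L(2)]
    by (simp add: algebra_simps)
  also have "134 * pi ^ 5 / 729 * sqrt 3 = 134 * pi ^ 5 / (243 * sqrt 3)"
    by (simp add: field_simps)
  finally have "complex_of_real (32 * sqrt 3 * (\<Sum>n. sin (real (Suc n) * (pi / 3)) * shifted_sum (Suc n))
      + 16 * sqrt 3 * Im (Li_nat 5 (cis (2 * pi / 3))))
    = - 72 * riemann_zeta 3 * L_m3 2 + complex_of_real (134 * pi ^ 5 / (243 * sqrt 3))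
     - complex_of_real (32 * sqrt 3 * Gl41 (pi / 3))"
    by (simp add: L(1) riemann_zeta_3)
  then show ?thesis
    using sums_of_real[OF fourth_deriv_gamma_ratio_sums_eq, where ?'a = complex] by (simp only:)
qed

end
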